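(* For every $V > 0$ and every $$\zeta > \frac{\log [(5 + 2V)^{1/2} (3 + V) a_V]}{\log \frac{\sqrt{5} + 1}{2}},$$ there is a constant $C > 0$ such that for every $\omega\in\mathbb{T}$, every $E \in \Sigma_V$ and every integer $N\ge 1$, we have $$\max_{0 \le |n-m| \le N} \|M(n,m,\omega,E)\| \le C N^\zeta ,$$ where the maximum is over integers $n,m$.
   Context: Let $\alpha = \frac{\sqrt{5}-1}{2}$. For $V>0$ and $\omega \in \mathbb{T} = \mathbb{R}/\mathbb{Z}$, the Fibonacci Hamiltonian is the bounded self-adjoint operator on $\ell^2(\mathbb{Z})$ given by $$[H_{V,\omega} \psi](n) = \psi(n+1) + \psi(n-1) + V \chi_{[1-\alpha,1)}(n\alpha + \omega \bmod 1)\, \psi(n).$$ Its spectrum does not depend on $\omega$; $\Sigma_V$ denotes the common spectrum, $\Sigma_V = \sigma(H_{V,\omega})$ for every $\omega \in \mathbb{T}$. $a_V$ denotes the largest root of the polynomial $x^3-(2+V)x-1$. $M(n,m,\omega,E)$ denotes the transfer matrix, i.e. the $\mathrm{SL}(2,\mathbb{R})$ matrix that maps $(u(m+1),u(m))^T$ to $(u(n+1),u(n))^T$ for every solution $u:\mathbb{Z}\to\mathbb{C}$ of the difference equation $H_{V,\omega}u=Eu$. *)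

theory Defs
  imports "HOL-Analysis.Analysis"
begin

section \<open>Spectra of operators on square-summable two-sided sequences\<close>

definition ell2 :: "(int \<Rightarrow> complex) set" where
  "ell2 = {\<psi>. (\<lambda>n. (cmod (\<psi> n))\<^sup>2) summable_on UNIV}"

definition ell2_norm :: "(int \<Rightarrow> complex) \<Rightarrow> real" where
  "ell2_norm \<psi> = sqrt (\<Sum>\<^sub>\<infinity>n. (cmod (\<psi> n))\<^sup>2)"

text \<open>
  Operators are given as maps on all sequences and restricted to \<^const>\<open>ell2\<close>. A point \<open>z\<close> lies
  outside the spectrum iff \<open>T - z\<close> is a bijection of \<^const>\<open>ell2\<close> with bounded inverse.
\<close>

definition ell2_spectrum :: "((int \<Rightarrow> complex) \<Rightarrow> (int \<Rightarrow> complex)) \<Rightarrow> complex set" where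
  "ell2_spectrum T =
     {z. \<not> (bij_betw (\<lambda>\<psi> n. T \<psi> n - z * \<psi> n) ell2 ell2 \<and>
            (\<exists>B. \<forall>\<psi>\<in>ell2. ell2_norm \<psi> \<le> B * ell2_norm (\<lambda>n. T \<psi> n - z * \<psi> n)))}"


section \<open>The Fibonacci Hamiltonian\<close>

definition \<alpha> :: real where
  "\<alpha> = (sqrt 5 - 1) / 2"

text \<open>
  Points of the circle are represented by arbitrary reals \<open>\<omega>\<close>; the potential depends on \<open>\<omega>\<close> only
  modulo 1.
\<close>

definition fib_potential :: "real \<Rightarrow> real \<Rightarrow> int \<Rightarrow> real" where
  "fib_potential V \<omega> n = V * indicator {1 - \<alpha>..<1} (frac (of_int n * \<alpha> + \<omega>))"

definition fib_H :: "real \<Rightarrow> real \<Rightarrow> (int \<Rightarrow> complex) \<Rightarrow> int \<Rightarrow> complex" where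
  "fib_H V \<omega> \<psi> n = \<psi> (n + 1) + \<psi> (n - 1) + of_real (fib_potential V \<omega> n) * \<psi> n"

text \<open>
  For \<open>V > 0\<close> the spectra for all phases coincide, so the union is the common spectrum. It is a
  set of complex numbers, contained in the real line because the operators are self-adjoint.
\<close>

definition fib_spectrum :: "real \<Rightarrow> complex set" where
  "fib_spectrum V = (\<Union>\<omega>. ell2_spectrum (fib_H V \<omega>))"

text \<open>All roots of this cubic are real when \<open>V > 0\<close>.\<close>

definition fib_a :: "real \<Rightarrow> real" where
  "fib_a V = Max {x::real. x ^ 3 - (2 + V) * x - 1 = 0}"


section \<open>Transfer matrices\<close>

definition fib_solution :: "real \<Rightarrow> real \<Rightarrow> complex \<Rightarrow> (int \<Rightarrow> complex) \<Rightarrow> bool" where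
  "fib_solution V \<omega> E u \<longleftrightarrow> (\<forall>n. fib_H V \<omega> u n = E * u n)"

definition is_transfer ::
  "real \<Rightarrow> int \<Rightarrow> int \<Rightarrow> real \<Rightarrow> complex \<Rightarrow> complex^2^2 \<Rightarrow> bool" where
  "is_transfer V n m \<omega> E A \<longleftrightarrow>
     (\<forall>u. fib_solution V \<omega> E u \<longrightarrow>
        (vector [u (n + 1), u n] :: complex^2) = A *v vector [u (m + 1), u m])"

text \<open>
  The entries are real and the determinant is 1 for real \<open>E\<close>. The description is well-defined for
  every complex \<open>E\<close>, see \<open>ex1_transfer\<close> below.
\<close>

definition fib_transfer :: "real \<Rightarrow> int \<Rightarrow> int \<Rightarrow> real \<Rightarrow> complex \<Rightarrow> complex^2^2" where
  "fib_transfer V n m \<omega> E = (THE A. is_transfer V n m \<omega> E A)"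

definition opnorm :: "complex^2^2 \<Rightarrow> real" where
  "opnorm A = onorm (\<lambda>x. A *v x)"

fun three_term :: "(nat \<Rightarrow> complex) \<Rightarrow> complex \<Rightarrow> complex \<Rightarrow> nat \<Rightarrow> complex" where
  "three_term q a b 0 = a"
| "three_term q a b (Suc 0) = b"
| "three_term q a b (Suc (Suc k)) = q k * three_term q a b (Suc k) - three_term q a b k"

lemma fib_solution_alt:
  "fib_solution V \<omega> E u \<longleftrightarrow>
     (\<forall>n. u (n + 1) = (E - of_real (fib_potential V \<omega> n)) * u n - u (n - 1))"
  unfolding fib_solution_def fib_H_def by (auto simp: algebra_simps)

lemma ex_fib_solution:
  "\<exists>u. fib_solution V \<omega> E u \<and> u (m + 1) = a \<and> u m = b"
proof -
  define q where "q n = E - of_real (fib_potential V \<omega> n)" for n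
  define F where "F = three_term (\<lambda>k. q (m + int k + 1)) b a"
  define G where "G = three_term (\<lambda>k. q (m - int k)) a b"
  define u where "u n = (if n \<ge> m then F (nat (n - m)) else G (nat (m + 1 - n)))" for n
  have uF: "u (m + int k) = F k" for k
    by (simp add: u_def)
  have uG: "u (m + 1 - int k) = G k" for k
  proof (cases "k \<le> 1")
    case True
    then have "k = 0 \<or> k = Suc 0" by auto
    then show ?thesis by (auto simp: u_def F_def G_def)
  qed (simp add: u_def)
  have "u (n + 1) = q n * u n - u (n - 1)" for n
  proof (cases "n > m")
    case True
    define k where "k = nat (n - m - 1)"
    have n: "n = m + int (Suc k)" using True by (simp add: k_def)
    have "n + 1 = m + int (Suc (Suc k))" "n - 1 = m + int k" using n by auto
    then have "u (n + 1) = F (Suc (Suc k))" "u n = F (Suc k)" "u (n - 1) = F k"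
      using n uF by metis+
    then show ?thesis using n by (simp add: F_def add_ac)
  next
    case False
    define k where "k = nat (m - n)"
    have n: "n = m + 1 - int (Suc k)" using False by (simp add: k_def)
    have "n + 1 = m + 1 - int k" "n - 1 = m + 1 - int (Suc (Suc k))" using n by auto
    then have "u (n + 1) = G k" "u n = G (Suc k)" "u (n - 1) = G (Suc (Suc k))"
      using n uG by metis+
    then show ?thesis using n by (simp add: G_def)
  qed
  moreover have "u (m + 1) = a" "u m = b"
    using uF[of 0] uF[of 1] by (simp_all add: F_def)
  ultimately show ?thesis unfolding fib_solution_alt q_def by blast
qed

lemma ex_transfer: "\<exists>A. is_transfer V n m \<omega> E A"
proof (induction n rule: int_induct[where k = m])
  case base
  have "is_transfer V m m \<omega> E (mat 1)" by (simp add: is_transfer_def)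
  then show ?case by blast
next
  case (step1 n)
  then obtain A where A: "is_transfer V n m \<omega> E A" by blast
  define q where "q = E - of_real (fib_potential V \<omega> (n + 1))"
  define S :: "complex^2^2" where "S = vector [vector [q, -1], vector [1, 0]]"
  have "is_transfer V (n + 1) m \<omega> E (S ** A)"
    unfolding is_transfer_def
  proof (intro allI impI)
    fix u assume u: "fib_solution V \<omega> E u"
    have "u (n + 1 + 1) = q * u (n + 1) - u n"
      using u[unfolded fib_solution_alt, rule_format, of "n + 1"] by (simp add: q_def)
    then have "(vector [u (n + 1 + 1), u (n + 1)] :: complex^2) = S *v vector [u (n + 1), u n]"
      by (simp add: S_def vec_eq_iff forall_2 matrix_vector_mult_def sum_2 vector_2)
    also have "\<dots> = (S ** A) *v vector [u (m + 1), u m]"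
      using A u by (simp add: is_transfer_def matrix_vector_mul_assoc)
    finally show "(vector [u (n + 1 + 1), u (n + 1)] :: complex^2) = \<dots>" .
  qed
  then show ?case by blast
next
  case (step2 n)
  then obtain A where A: "is_transfer V n m \<omega> E A" by blast
  define q where "q = E - of_real (fib_potential V \<omega> n)"
  define S :: "complex^2^2" where "S = vector [vector [0, 1], vector [-1, q]]"
  have "is_transfer V (n - 1) m \<omega> E (S ** A)"
    unfolding is_transfer_def
  proof (intro allI impI)
    fix u assume u: "fib_solution V \<omega> E u"
    have "u (n - 1) = q * u n - u (n + 1)"
      using u[unfolded fib_solution_alt, rule_format, of n] by (simp add: q_def)
    then have "(vector [u (n - 1 + 1), u (n - 1)] :: complex^2) = S *v vector [u (n + 1), u n]"
      by (simp add: S_def vec_eq_iff forall_2 matrix_vector_mult_def sum_2 vector_2)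
    also have "\<dots> = (S ** A) *v vector [u (m + 1), u m]"
      using A u by (simp add: is_transfer_def matrix_vector_mul_assoc)
    finally show "(vector [u (n - 1 + 1), u (n - 1)] :: complex^2) = \<dots>" .
  qed
  then show ?case by blast
qed

lemma ex1_transfer: "\<exists>!A. is_transfer V n m \<omega> E A"
proof (rule ex_ex1I[OF ex_transfer])
  fix A B assume AB: "is_transfer V n m \<omega> E A" "is_transfer V n m \<omega> E B"
  have "A *v x = B *v x" for x
  proof -
    obtain u where u: "fib_solution V \<omega> E u" "u (m + 1) = x $ 1" "u m = x $ 2"
      using ex_fib_solution by blast
    have "x = vector [u (m + 1), u m]"
      using u by (simp add: vec_eq_iff forall_2 vector_2)
    then show ?thesis using AB u(1) by (simp add: is_transfer_def)
  qed
  then show "A = B" by (simp add: matrix_eq)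
qed

lemma is_transfer_fib_transfer: "is_transfer V n m \<omega> E (fib_transfer V n m \<omega> E)"
  unfolding fib_transfer_def by (rule theI'[OF ex1_transfer])

end

theory Submission
  imports Defs "HOL-Number_Theory.Fib"
begin

text \<open>
  Every window of a Sturmian word of slope \<open>\<alpha>\<close> is, up to one letter at each end, the image of a
  shorter window under the substitution \<open>A \<mapsto> A B, B \<mapsto> A\<close>, and the matrices of the two letters pass
  from \<open>(A, B)\<close> to \<open>(B A, A)\<close>. Writing the product over a window as a combination of \<open>1, B, A, B A\<close>,
  Cayley-Hamilton expresses one level of the hierarchy linearly in the coefficients, with factors
  bounded by the traces. On the spectrum these are at most \<open>T = 2 + V\<close>, and in a suitably weighted
  maximum norm one level costs a factor \<open>(7/5 T + 3/10) (1 + T)\<close>, which is at most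
  \<open>sqrt (5 + 2 V) (3 + V) a\<^sub>V\<close> because \<open>a\<^sub>V \<ge> sqrt T\<close>. A window of length \<open>N\<close> is exhausted after
  about \<open>log N / log \<phi>\<close> levels.

  The trace bound: if two consecutive traces exceed 2 in modulus at a real energy, all later ones
  do so on a whole neighbourhood of it. The operator then has a lower bound there, because on a long
  window it agrees with a periodic operator of Fibonacci period, whose eigenvalues (with periodic
  boundary conditions) have trace exactly 2.
\<close>

section \<open>Two by two matrices\<close>

text \<open>Only the traces of the higher-level matrices are under control, not their norms. In the
  basis \<open>1, B, A, B A\<close> each operation of the hierarchy (one substitution level, removal
  of a letter at either end) has coefficients built from traces, so norms enter once only, for the
  two one-letter matrices at the bottom.

  Desubstitution acts on slopes by \<open>x\<close> to \<open>1 / x - 1\<close>. This map fixes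
  \<alpha> and sends each quotient of consecutive Fibonacci numbers to the preceding one. Balanced
  functions of a general slope in [1/2, 1] therefore serve twice: for the growth estimate at slope
  \<alpha>, and for recognising the trace over one period of an approximant as a Fibonacci trace.

  The delicate point of the trace bound is uniformity: the lower bound at an escaping energy must
  not depend on the window. Its constant is the radius of the neighbourhood of escape, and it passes
  unchanged from the periodic operators to finitely supported sequences and on to
  \<open>ell2\<close>. There it gives injectivity with a bounded inverse, and surjectivity by way of
  the adjoint.\<close>

definition mat2 :: "complex \<Rightarrow> complex \<Rightarrow> complex \<Rightarrow> complex \<Rightarrow> complex^2^2" where
  "mat2 a b c d = vector [vector [a, b], vector [c, d]]"

lemma mat2_nth [simp]:
  "mat2 a b c d $ 1 $ 1 = a" "mat2 a b c d $ 1 $ 2 = b"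
  "mat2 a b c d $ 2 $ 1 = c" "mat2 a b c d $ 2 $ 2 = d"
  by (simp_all add: mat2_def)

definition adj2 :: "complex^2^2 \<Rightarrow> complex^2^2" where
  "adj2 A = mat2 (A$2$2) (- A$1$2) (- A$2$1) (A$1$1)"

lemma mat2_eqI:
  fixes A B :: "complex^2^2"
  assumes "A$1$1 = B$1$1" "A$1$2 = B$1$2" "A$2$1 = B$2$1" "A$2$2 = B$2$2"
  shows "A = B"
  using assms by (simp add: vec_eq_iff forall_2)

lemma mult2_nth:
  fixes A B :: "complex^2^2"
  shows "(A ** B) $ i $ j = A$i$1 * B$1$j + A$i$2 * B$2$j"
  by (simp add: matrix_matrix_mult_def sum_2)

lemma mat_nth: "(mat c :: complex^2^2) $ i $ j = (if i = j then c else 0)"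
  by (simp add: mat_def)

lemma trace2: "trace (A :: complex^2^2) = A$1$1 + A$2$2"
  by (simp add: trace_def sum_2)

lemmas mat2_simps = mult2_nth mat_nth trace2 adj2_def det_2

lemma mult2_add_distrib:
  fixes A B C :: "complex^2^2"
  shows "(A + B) ** C = A ** C + B ** C"
  by (rule mat2_eqI) (simp_all add: mult2_nth algebra_simps)

lemma adj2_inverse:
  assumes "det (A :: complex^2^2) = 1"
  shows "A ** adj2 A = mat 1" "adj2 A ** A = mat 1"
  using assms by (auto intro!: mat2_eqI simp: mat2_simps algebra_simps)

text \<open>The Cayley-Hamilton identity for \<open>B ** A\<close>, divided by \<open>B\<close>.\<close>

lemma mult_ABA:
  assumes "det (A :: complex^2^2) = 1" "det B = 1"
  shows "A ** (B ** A) = mat (trace (B ** A)) ** A + B - mat (trace B)"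
proof -
  have "B$1$1 * A$1$1 * A$2$2 - B$1$1 * A$1$2 * A$2$1 = B$1$1"
    "B$1$2 * A$1$1 * A$2$2 - B$1$2 * A$1$2 * A$2$1 = B$1$2"
    "B$2$1 * A$1$1 * A$2$2 - B$2$1 * A$1$2 * A$2$1 = B$2$1"
    "B$2$2 * A$1$1 * A$2$2 - B$2$2 * A$1$2 * A$2$1 = B$2$2"
    using assms(1) unfolding det_2 by algebra+
  then show ?thesis
    by (intro mat2_eqI) (simp_all add: mat2_simps algebra_simps)
qed

text \<open>Submultiplicative, above the operator norm and invariant under the adjugate, so that
  inverses of unimodular matrices cost nothing.\<close>

definition entry_norm :: "complex^2^2 \<Rightarrow> real" where
  "entry_norm A = cmod (A$1$1) + cmod (A$1$2) + cmod (A$2$1) + cmod (A$2$2)"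

lemma entry_norm_nonneg: "0 \<le> entry_norm A"
  by (simp add: entry_norm_def)

lemma entry_norm_adj2: "entry_norm (adj2 A) = entry_norm A"
  by (simp add: entry_norm_def adj2_def)

lemma entry_norm_add: "entry_norm (A + B) \<le> entry_norm A + entry_norm B"
  unfolding entry_norm_def vector_add_component
  by (smt (verit) norm_triangle_ineq)

lemma entry_norm_scale: "entry_norm (mat c ** A) = cmod c * entry_norm A"
  unfolding entry_norm_def by (simp add: mult2_nth mat_nth norm_mult algebra_simps)

lemma entry_norm_mult: "entry_norm (A ** B) \<le> entry_norm A * entry_norm B"
proof -
  have t: "cmod (a * b + c * d) \<le> cmod a * cmod b + cmod c * cmod d" for a b c d
    by (metis norm_mult norm_triangle_ineq)
  have "entry_norm (A ** B) \<le>
      (cmod (A$1$1) * cmod (B$1$1) + cmod (A$1$2) * cmod (B$2$1)) +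
      (cmod (A$1$1) * cmod (B$1$2) + cmod (A$1$2) * cmod (B$2$2)) +
      (cmod (A$2$1) * cmod (B$1$1) + cmod (A$2$2) * cmod (B$2$1)) +
      (cmod (A$2$1) * cmod (B$1$2) + cmod (A$2$2) * cmod (B$2$2))"
    unfolding entry_norm_def mult2_nth by (intro add_mono t)
  also have "\<dots> \<le> entry_norm A * entry_norm B"
    unfolding entry_norm_def by (simp add: algebra_simps)
  finally show ?thesis .
qed

lemma opnorm_le_entry_norm: "opnorm A \<le> entry_norm A"
  unfolding opnorm_def
proof (rule onorm_le)
  fix x :: "complex^2"
  have n: "norm y \<le> cmod (y$1) + cmod (y$2)" for y :: "complex^2"
    unfolding norm_vec_def L2_set_def sum_2 by (rule sqrt_sum_squares_le_sum) auto
  have c: "cmod (x$i) \<le> norm x" for i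
    by (rule Finite_Cartesian_Product.norm_nth_le)
  have "norm (A *v x) \<le> cmod ((A *v x)$1) + cmod ((A *v x)$2)" by (rule n)
  also have "\<dots> \<le> (cmod (A$1$1) * cmod (x$1) + cmod (A$1$2) * cmod (x$2))
      + (cmod (A$2$1) * cmod (x$1) + cmod (A$2$2) * cmod (x$2))"
    by (simp add: matrix_vector_mult_def sum_2)
       (intro add_mono; metis norm_mult norm_triangle_ineq)
  also have "\<dots> \<le> (cmod (A$1$1) * norm x + cmod (A$1$2) * norm x)
      + (cmod (A$2$1) * norm x + cmod (A$2$2) * norm x)"
    by (intro add_mono mult_left_mono c) auto
  also have "\<dots> = entry_norm A * norm x" by (simp add: entry_norm_def algebra_simps)
  finally show "norm (A *v x) \<le> entry_norm A * norm x" .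
qed

section \<open>Combinations of words in a pair of unimodular matrices\<close>

text \<open>Bounds are kept on the coefficients and not on the matrix, because \<open>A\<close> and
  \<open>B\<close> themselves change from level to level and are large.\<close>

definition span_box ::
  "complex^2^2 \<Rightarrow> complex^2^2 \<Rightarrow> real \<Rightarrow> real \<Rightarrow> real \<Rightarrow> real \<Rightarrow> (complex^2^2) set" where
  "span_box A B s0 s1 s2 s3 =
     {mat c0 + mat c1 ** B + mat c2 ** A + mat c3 ** (B ** A) | c0 c1 c2 c3.
        cmod c0 \<le> s0 \<and> cmod c1 \<le> s1 \<and> cmod c2 \<le> s2 \<and> cmod c3 \<le> s3}"

lemma span_box_mono:
  assumes "X \<in> span_box A B s0 s1 s2 s3" "s0 \<le> t0" "s1 \<le> t1" "s2 \<le> t2" "s3 \<le> t3"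
  shows "X \<in> span_box A B t0 t1 t2 t3"
proof -
  from assms(1) obtain c0 c1 c2 c3 where
    "X = mat c0 + mat c1 ** B + mat c2 ** A + mat c3 ** (B ** A)"
    "cmod c0 \<le> s0" "cmod c1 \<le> s1" "cmod c2 \<le> s2" "cmod c3 \<le> s3"
    unfolding span_box_def by blast
  with assms(2-) show ?thesis unfolding span_box_def by (fastforce intro: order_trans)
qed

lemma span_boxI:
  assumes "X = mat c0 + mat c1 ** B + mat c2 ** A + mat c3 ** (B ** A)"
    "cmod c0 \<le> s0" "cmod c1 \<le> s1" "cmod c2 \<le> s2" "cmod c3 \<le> s3"
  shows "X \<in> span_box A B s0 s1 s2 s3"
  using assms unfolding span_box_def by blast

lemma cmod_add_mult_le:
  assumes "cmod c \<le> s" "cmod d \<le> r" "cmod t \<le> T"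
  shows "cmod (c + t * d) \<le> s + T * r" "cmod (c - t * d) \<le> s + T * r"
    "cmod (t * d + c) \<le> T * r + s"
proof -
  have *: "cmod (t * d) \<le> T * r"
    unfolding norm_mult using assms(2,3) by (meson mult_mono norm_ge_zero order_trans)
  show "cmod (c + t * d) \<le> s + T * r" "cmod (c - t * d) \<le> s + T * r"
    using * assms(1) norm_triangle_ineq[of c "t * d"] norm_triangle_ineq4[of c "t * d"] by linarith+
  then show "cmod (t * d + c) \<le> T * r + s" by (simp add: add.commute)
qed

context
  fixes A B :: "complex^2^2" and T :: real
  assumes det: "det A = 1" "det B = 1"
    and tr: "cmod (trace A) \<le> T" "cmod (trace B) \<le> T" "cmod (trace (B ** A)) \<le> T"
begin

text \<open>The basis words of the pair \<open>(B ** A, A)\<close> are \<open>1\<close>,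
  \<open>A\<close>, \<open>B A\<close> and \<open>A B A\<close>. The first three are basis words of
  \<open>(A, B)\<close> already, and \<open>mult_ABA\<close> reduces the fourth.\<close>

lemma span_box_descend:
  assumes "X \<in> span_box (B ** A) A s0 s1 s2 s3"
  shows "X \<in> span_box A B (s0 + T * s3) s3 (s1 + T * s3) s2"
proof -
  from assms obtain c0 c1 c2 c3 where
    X: "X = mat c0 + mat c1 ** A + mat c2 ** (B ** A) + mat c3 ** (A ** (B ** A))"
    and c: "cmod c0 \<le> s0" "cmod c1 \<le> s1" "cmod c2 \<le> s2" "cmod c3 \<le> s3"
    unfolding span_box_def by blast
  show ?thesis
  proof (rule span_boxI)
    show "X = mat (c0 - trace B * c3) + mat c3 ** B + mat (c1 + trace (B ** A) * c3) ** A
        + mat c2 ** (B ** A)"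
      unfolding X mult_ABA[OF det]
      by (rule mat2_eqI) (simp_all add: mult2_nth mat_nth algebra_simps)
  qed (intro cmod_add_mult_le c tr)+
qed

text \<open>Cayley-Hamilton in the form \<open>adj2 A = trace A - A\<close>: removing a letter
  \<open>A\<close> on the right permutes the coefficients up to sign and adds one trace multiple.
  \<open>span_box_adj_left\<close> is the mirror image.\<close>

lemma span_box_adj_right:
  assumes "X \<in> span_box A B s0 s1 s2 s3"
  shows "X ** adj2 A \<in> span_box A B (T * s0 + s2) (T * s1 + s3) s0 s1"
proof -
  from assms obtain c0 c1 c2 c3 where
    X: "X = mat c0 + mat c1 ** B + mat c2 ** A + mat c3 ** (B ** A)"
    and c: "cmod c0 \<le> s0" "cmod c1 \<le> s1" "cmod c2 \<le> s2" "cmod c3 \<le> s3"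
    unfolding span_box_def by blast
  have "(mat c0 + mat c1 ** B + mat c2 ** A + mat c3 ** (B ** A)) ** adj2 A
      = mat c0 ** adj2 A + mat c1 ** (B ** adj2 A) + mat c2 ** (A ** adj2 A)
        + mat c3 ** (B ** (A ** adj2 A))"
    by (simp add: mult2_add_distrib matrix_mul_assoc)
  also have "\<dots> = mat (trace A * c0 + c2) + mat (trace A * c1 + c3) ** B + mat (- c0) ** A
      + mat (- c1) ** (B ** A)"
    unfolding adj2_inverse(1)[OF det(1)]
    by (rule mat2_eqI) (simp_all add: mat2_simps algebra_simps)
  finally show ?thesis unfolding X
    by (rule span_boxI) (use c tr in \<open>auto intro!: cmod_add_mult_le\<close>)
qed

lemma span_box_adj_left:
  assumes "X \<in> span_box A B s0 s1 s2 s3"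
  shows "adj2 B ** X \<in> span_box A B (T * s0 + s1) s0 (T * s2 + s3) s2"
proof -
  from assms obtain c0 c1 c2 c3 where
    X: "X = mat c0 + mat c1 ** B + mat c2 ** A + mat c3 ** (B ** A)"
    and c: "cmod c0 \<le> s0" "cmod c1 \<le> s1" "cmod c2 \<le> s2" "cmod c3 \<le> s3"
    unfolding span_box_def by blast
  have s: "adj2 B ** mat c = mat c ** adj2 B" for c
    by (rule mat2_eqI) (simp_all add: mat2_simps)
  have "adj2 B ** (mat c0 + mat c1 ** B + mat c2 ** A + mat c3 ** (B ** A))
      = mat c0 ** adj2 B + mat c1 ** (adj2 B ** B) + mat c2 ** (adj2 B ** A)
        + mat c3 ** ((adj2 B ** B) ** A)"
    by (simp add: matrix_add_ldistrib matrix_mul_assoc s)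
  also have "\<dots> = mat (trace B * c0 + c1) + mat (- c0) ** B + mat (trace B * c2 + c3) ** A
      + mat (- c2) ** (B ** A)"
    unfolding adj2_inverse(2)[OF det(2)]
    by (rule mat2_eqI) (simp_all add: mat2_simps algebra_simps)
  finally show ?thesis unfolding X
    by (rule span_boxI) (use c tr in \<open>auto intro!: cmod_add_mult_le\<close>)
qed

end

text \<open>
  The weights make one level of the hierarchy cost a factor of order \<open>T\<^sup>2\<close> only; the plain sum of
  the coefficients would lose a power of \<open>T\<close>.
\<close>

definition growth_box :: "complex^2^2 \<Rightarrow> complex^2^2 \<Rightarrow> real \<Rightarrow> real \<Rightarrow> (complex^2^2) set" where
  "growth_box A B T S = span_box A B S (S / T) (S / T) (S / T\<^sup>2)"

text \<open>The first factor is a linear minorant of \<open>sqrt (T * (2 * T + 1))\<close>, with 7/5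
  slightly below \<open>sqrt 2\<close>. For \<open>T = 2 + V\<close> the radicand is
  \<open>(2 + V) * (5 + 2 * V)\<close>, and \<open>1 + T\<close> is the factor \<open>3 + V\<close>
  of the target.\<close>

definition growth_rate :: "real \<Rightarrow> real" where
  "growth_rate T = (7 / 5 * T + 3 / 10) * (1 + T)"

lemma growth_box_step:
  assumes det: "det A = 1" "det B = 1"
    and tr: "cmod (trace A) \<le> T" "cmod (trace B) \<le> T" "cmod (trace (B ** A)) \<le> T"
    and T: "T \<ge> 2" and S: "S \<ge> 0" and X: "X \<in> growth_box (B ** A) A T S"
  shows "X \<in> growth_box A B T (growth_rate T * S)"
    and "X ** adj2 A \<in> growth_box A B T (growth_rate T * S)"
    and "adj2 B ** X \<in> growth_box A B T (growth_rate T * S)"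
    and "adj2 B ** (X ** adj2 A) \<in> growth_box A B T (growth_rate T * S)"
proof -
  \<comment> \<open>With \<open>T * p = S\<close> and \<open>T * q = p\<close> every required bound
    is linear in the atoms \<open>T * (T * S)\<close>, \<open>T * S\<close>, \<open>S\<close>,
    \<open>p\<close>, \<open>q\<close>, each at least twice the next one because
    \<open>T \<ge> 2\<close>.\<close>
  define p q where "p = S / T" and "q = S / T\<^sup>2"
  have mult: "T * p = S" "T * q = p"
    using T by (simp_all add: p_def q_def power2_eq_square)
  have "growth_rate T * p = 7/5 * (T * (T * p)) + 17/10 * (T * p) + 3/10 * p"
    "growth_rate T * q = 7/5 * (T * (T * q)) + 17/10 * (T * q) + 3/10 * q"
    "growth_rate T * S = 7/5 * (T * (T * S)) + 17/10 * (T * S) + 3/10 * S"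
    unfolding growth_rate_def by algebra+
  then have rate: "growth_rate T * S / T = 7/5 * (T * S) + 17/10 * S + 3/10 * p"
    "growth_rate T * S / T\<^sup>2 = 7/5 * S + 17/10 * p + 3/10 * q"
    "growth_rate T * S = 7/5 * (T * (T * S)) + 17/10 * (T * S) + 3/10 * S"
    unfolding mult by (simp_all add: p_def q_def)
  have q: "0 \<le> q" using S by (simp add: q_def)
  have double: "2 * r \<le> T * r" if "0 \<le> r" for r
    using T that by (rule mult_right_mono)
  have pos: "2 * q \<le> p" "2 * p \<le> S" "2 * S \<le> T * S" "2 * (T * S) \<le> T * (T * S)"
    using double[OF q] double[of p] double[OF S] double[of "T * S"] S T
    unfolding mult p_def by simp_all
  note bounds = mult rate q pos
  from X have "X \<in> span_box (B ** A) A S p p q"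
    by (simp add: growth_box_def p_def q_def)
  note X1 = span_box_descend[OF det tr this]
  note X2 = span_box_adj_right[OF det tr X1]
  show "X \<in> growth_box A B T (growth_rate T * S)"
    unfolding growth_box_def
    by (rule span_box_mono[OF X1]) (use bounds in \<open>simp_all add: distrib_left\<close>)
  show "X ** adj2 A \<in> growth_box A B T (growth_rate T * S)"
    unfolding growth_box_def
    by (rule span_box_mono[OF X2]) (use bounds in \<open>simp_all add: distrib_left\<close>)
  show "adj2 B ** X \<in> growth_box A B T (growth_rate T * S)"
    unfolding growth_box_def
    by (rule span_box_mono[OF span_box_adj_left[OF det tr X1]])
      (use bounds in \<open>simp_all add: distrib_left\<close>)
  \<comment> \<open>The critical case: with letters removed at both ends the constant coefficient is
    bounded by \<open>(T^2 + T + 2 + 2 / T) * S\<close>. At \<open>T = 2\<close> this is 9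
    \<open>S\<close>, against a growth rate of 9.3.\<close>
  show "adj2 B ** (X ** adj2 A) \<in> growth_box A B T (growth_rate T * S)"
    unfolding growth_box_def
    by (rule span_box_mono[OF span_box_adj_left[OF det tr X2]])
      (use bounds in \<open>simp_all add: distrib_left\<close>)
qed

section \<open>Ordered products along the integers\<close>

fun run_prod :: "(int \<Rightarrow> complex^2^2) \<Rightarrow> int \<Rightarrow> nat \<Rightarrow> complex^2^2" where
  "run_prod g m 0 = mat 1"
| "run_prod g m (Suc k) = g (m + int k) ** run_prod g m k"

lemma run_prod_add: "run_prod g m (j + k) = run_prod g (m + int j) k ** run_prod g m j"
  by (induction k) (simp_all add: matrix_mul_assoc add.assoc)

lemma run_prod_Suc_left: "run_prod g m (Suc k) = run_prod g (m + 1) k ** g m"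
  using run_prod_add[of g m 1 k] by simp

lemma run_prod_split:
  assumes "l \<le> m" "m \<le> n"
  shows "run_prod g l (nat (n - l)) = run_prod g m (nat (n - m)) ** run_prod g l (nat (m - l))"
proof -
  have "nat (n - l) = nat (m - l) + nat (n - m)" "l + int (nat (m - l)) = m" using assms by auto
  then show ?thesis by (metis run_prod_add)
qed

lemma det_run_prod: "(\<And>i. det (g i) = 1) \<Longrightarrow> det (run_prod g m k) = 1"
  by (induction k) (simp_all add: det_mul)

lemma trace_run_prod_shift:
  assumes "g (m + int q) = g m"
  shows "trace (run_prod g (m + 1) q) = trace (run_prod g m q)"
proof (cases q)
  case (Suc k)
  have "trace (run_prod g (m + 1) q) = trace (g (m + int q) ** run_prod g (m + 1) k)"
    by (simp add: Suc add_ac)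
  also have "\<dots> = trace (run_prod g (m + 1) k ** g m)"
    unfolding assms by (rule trace_mul_sym)
  finally show ?thesis by (simp add: Suc run_prod_Suc_left del: run_prod.simps)
qed simp

section \<open>Balanced integer functions and their derivatives\<close>

text \<open>
  The increments of such functions are the Sturmian words of slope \<open>x\<close>; the condition avoids both
  the phase and the distinction between floor and ceiling.
\<close>

definition balanced :: "real \<Rightarrow> (int \<Rightarrow> int) \<Rightarrow> bool" where
  "balanced x h \<longleftrightarrow> (\<forall>n m. \<bar>real_of_int (h n - h m) - real_of_int (n - m) * x\<bar> < 1)"

definition letter :: "'a \<Rightarrow> 'a \<Rightarrow> (int \<Rightarrow> int) \<Rightarrow> int \<Rightarrow> 'a" where
  "letter A B h n = (if h (n + 1) = h n then B else A)"

definition ascent :: "(int \<Rightarrow> int) \<Rightarrow> int \<Rightarrow> int" where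
  "ascent h j = (THE n. h n = j - 1 \<and> h (n + 1) = j)"

text \<open>Up to an additive constant this counts the letters \<open>B\<close> before the
  \<open>j\<close>-th letter \<open>A\<close>. It is flat where the next \<open>A\<close> follows at
  once and rises by 1 where a \<open>B\<close> lies between.\<close>

definition derived :: "(int \<Rightarrow> int) \<Rightarrow> int \<Rightarrow> int" where
  "derived h j = ascent h j - j"

text \<open>A slope of at least 1/2 excludes two adjacent flat steps, so consecutive ascents are at
  distance 1 or 2. The range contains \<alpha> and the Fibonacci quotients
  \<open>fib (j + 1) / fib (j + 2)\<close>.\<close>

locale balanced_word =
  fixes x :: real and h :: "int \<Rightarrow> int"
  assumes slope: "1/2 \<le> x" "x \<le> 1" and bal: "balanced x h"
begin

lemma diff_lt: "\<bar>real_of_int (h n - h m) - real_of_int (n - m) * x\<bar> < 1"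
  using bal by (simp add: balanced_def)

lemma h_step: "h (n + 1) = h n \<or> h (n + 1) = h n + 1"
proof -
  have "\<bar>real_of_int (h (n + 1) - h n) - x\<bar> < 1" using diff_lt[of "n + 1" n] by simp
  then have "real_of_int (h (n + 1) - h n) < 2" "real_of_int (h (n + 1) - h n) > - 1"
    using slope by linarith+
  then have "h (n + 1) - h n < 2" "h (n + 1) - h n > - 1" by linarith+
  then show ?thesis by linarith
qed

lemma two_step: "h (n + 2) > h n"
proof -
  have "\<bar>real_of_int (h (n + 2) - h n) - 2 * x\<bar> < 1" using diff_lt[of "n + 2" n] by simp
  then have "real_of_int (h (n + 2) - h n) > 0" using slope by linarith
  then show ?thesis by linarith
qed

lemma mono_h: "m \<le> n \<Longrightarrow> h m \<le> h n"
proof (induction n rule: int_ge_induct)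
  case (step i)
  then show ?case using h_step[of i] by auto
qed simp

lemma ex_ascent: "\<exists>n. h n = j - 1 \<and> h (n + 1) = j"
proof -
  have even: "h (2 * int k) \<ge> h 0 + int k \<and> h (- 2 * int k) \<le> h 0 - int k" for k
  proof (induction k)
    case (Suc k)
    then show ?case
      using two_step[of "2 * int k"] two_step[of "- 2 * int (Suc k)"] by (simp add: algebra_simps)
  qed simp
  define k where "k = nat (\<bar>h 0\<bar> + \<bar>j\<bar> + 1)"
  have "int k = \<bar>h 0\<bar> + \<bar>j\<bar> + 1" by (simp add: k_def)
  then have lo: "h (- 2 * int k) < j" and hi: "h (2 * int k) \<ge> j"
    using even[of k] by linarith+
  define i where "i = (LEAST i. h (- 2 * int k + int i) \<ge> j)"
  have "h (- 2 * int k + int (4 * k)) \<ge> j" using hi by simp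
  then have i: "h (- 2 * int k + int i) \<ge> j" unfolding i_def by (rule LeastI)
  then have "i \<noteq> 0" using lo by (cases i) auto
  then obtain i' where i': "i = Suc i'" by (cases i) auto
  have "\<not> h (- 2 * int k + int i') \<ge> j"
    using not_less_Least[of i' "\<lambda>i. h (- 2 * int k + int i) \<ge> j"] i' by (simp add: i_def)
  moreover have "- 2 * int k + int i = - 2 * int k + int i' + 1" by (simp add: i')
  then have "h (- 2 * int k + int i' + 1) \<ge> j" using i by metis
  ultimately have "h (- 2 * int k + int i') = j - 1 \<and> h (- 2 * int k + int i' + 1) = j"
    using h_step[of "- 2 * int k + int i'"] by linarith
  then show ?thesis by blast
qed

lemma ascent_unique:
  assumes "h n = j - 1" "h (n + 1) = j" "h n' = j - 1" "h (n' + 1) = j"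
  shows "n = n'"
proof -
  have "\<not> n + 1 \<le> n'" using mono_h[of "n + 1" n'] assms by auto
  moreover have "\<not> n' + 1 \<le> n" using mono_h[of "n' + 1" n] assms by auto
  ultimately show ?thesis by linarith
qed

lemma ascent: "h (ascent h j) = j - 1" "h (ascent h j + 1) = j"
proof -
  have "\<exists>!n. h n = j - 1 \<and> h (n + 1) = j" using ex_ascent ascent_unique by blast
  from theI'[OF this] show "h (ascent h j) = j - 1" "h (ascent h j + 1) = j"
    by (simp_all add: ascent_def)
qed

lemma ascent_eqI: "h n = j - 1 \<Longrightarrow> h (n + 1) = j \<Longrightarrow> ascent h j = n"
  using ascent ascent_unique by blast

text \<open>Balance is applied with one of the two endpoints moved across its own ascent. This
  improves the bound 1 to \<open>x\<close>, just enough to be again 1 after division by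
  \<open>x\<close>.\<close>

lemma ascent_diff:
  "\<bar>real_of_int (ascent h j - ascent h i) * x - real_of_int (j - i)\<bar> < x"
proof -
  have "\<bar>real_of_int (h (ascent h j) - h (ascent h i + 1))
      - real_of_int (ascent h j - (ascent h i + 1)) * x\<bar> < 1"
    "\<bar>real_of_int (h (ascent h j + 1) - h (ascent h i))
      - real_of_int (ascent h j + 1 - ascent h i) * x\<bar> < 1"
    by (rule diff_lt)+
  then show ?thesis unfolding ascent by (simp add: algebra_simps abs_less_iff)
qed

text \<open>Renormalisation closes up here: at slope \<alpha> the new slope is again \<alpha>, and
  at \<open>fib (j + 2) / fib (j + 3)\<close> it is
  \<open>fib (j + 1) / fib (j + 2)\<close>.\<close>

lemma balanced_derived: "balanced (1 / x - 1) (derived h)"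
  unfolding balanced_def
proof (intro allI)
  fix j i
  have "real_of_int (derived h j - derived h i) - real_of_int (j - i) * (1 / x - 1)
      = (real_of_int (ascent h j - ascent h i) * x - real_of_int (j - i)) / x"
    using slope by (simp add: derived_def field_simps)
  also have "\<bar>\<dots>\<bar> < 1" using ascent_diff[of j i] slope by (simp add: divide_simps)
  finally show "\<bar>real_of_int (derived h j - derived h i) - real_of_int (j - i) * (1 / x - 1)\<bar> < 1" .
qed

lemma ascent_Suc:
  "ascent h (j + 1) = ascent h j + 1 \<or>
   ascent h (j + 1) = ascent h j + 2 \<and> h (ascent h j + 2) = h (ascent h j + 1)"
proof -
  have b: "\<bar>real_of_int (ascent h (j + 1) - ascent h j) * x - 1\<bar> < x"
    using ascent_diff[of "j + 1" j] by simp
  define d where "d = ascent h (j + 1) - ascent h j"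
  have "real_of_int d > 0"
  proof (rule ccontr)
    assume "\<not> real_of_int d > 0"
    then have "real_of_int d * x \<le> 0" using slope by (simp add: mult_nonpos_nonneg)
    then show False using b slope unfolding d_def by linarith
  qed
  moreover have "real_of_int d < 3"
  proof (rule ccontr)
    assume "\<not> real_of_int d < 3"
    then have "3 * x \<le> real_of_int d * x" using slope by (intro mult_right_mono) auto
    then show False using b slope unfolding d_def by linarith
  qed
  ultimately have "d = 1 \<or> d = 2" by linarith
  then show ?thesis
  proof
    assume "d = 2"
    then have e: "ascent h (j + 1) = ascent h j + 2" by (simp add: d_def)
    then have "h (ascent h j + 2) = h (ascent h j + 1)"
      using ascent(1)[of "j + 1"] ascent(2)[of j] by simp
    with e show ?thesis by simp
  qed (simp add: d_def)
qed

lemma ascent_mono: "i \<le> j \<Longrightarrow> ascent h i \<le> ascent h j"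
proof (induction j rule: int_ge_induct)
  case (step j)
  then show ?case using ascent_Suc[of j] by linarith
qed simp

lemma ascent_le_iff: "ascent h i \<le> ascent h j \<longleftrightarrow> i \<le> j"
proof
  assume "ascent h i \<le> ascent h j"
  then have "h (ascent h i) \<le> h (ascent h j)" by (rule mono_h)
  then show "i \<le> j" by (simp add: ascent)
qed (rule ascent_mono)

text \<open>From one ascent to the next the word reads \<open>A\<close> or \<open>A B\<close>. Later
  letters multiply from the left, so the block \<open>A B\<close> contributes
  \<open>B ** A\<close>.\<close>

lemma run_prod_derived:
  assumes "i \<le> j"
  shows "run_prod (letter A B h) (ascent h i) (nat (ascent h j - ascent h i))
    = run_prod (letter (B ** A) A (derived h)) i (nat (j - i))"
  using assms
proof (induction j rule: int_ge_induct)
  case (step j)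
  let ?p = "run_prod (letter A B h)"
  let ?p' = "run_prod (letter (B ** A) A (derived h))"
  have A: "letter A B h (ascent h j) = A" using ascent[of j] by (simp add: letter_def)
  have block: "?p (ascent h j) (nat (ascent h (j + 1) - ascent h j))
      = letter (B ** A) A (derived h) j"
    using ascent_Suc[of j]
  proof
    assume "ascent h (j + 1) = ascent h j + 1"
    then show ?thesis by (simp add: A) (simp add: letter_def derived_def)
  next
    assume *: "ascent h (j + 1) = ascent h j + 2 \<and> h (ascent h j + 2) = h (ascent h j + 1)"
    then have B: "letter A B h (ascent h j + 1) = B" by (simp add: letter_def add.assoc)
    have "?p (ascent h j) (nat (ascent h (j + 1) - ascent h j)) = B ** A"
      using * by (simp add: A B numeral_2_eq_2)
    also have "\<dots> = letter (B ** A) A (derived h) j" using * by (simp add: letter_def derived_def)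
    finally show ?thesis .
  qed
  have "?p (ascent h i) (nat (ascent h (j + 1) - ascent h i))
      = letter (B ** A) A (derived h) j ** ?p' i (nat (j - i))"
    using run_prod_split[of "ascent h i" "ascent h j" "ascent h (j + 1)" "letter A B h"]
      step ascent_mono[of i j] ascent_mono[of j "j + 1"] block by simp
  also have "\<dots> = ?p' i (nat (j + 1 - i))"
    using run_prod_split[of i j "j + 1" "letter (B ** A) A (derived h)"] step.hyps by simp
  finally show ?case .
qed simp

text \<open>If the step at \<open>m\<close> is flat, the one before it must rise; so a block
  boundary is at most one letter to the left.\<close>

lemma ascent_near: "\<exists>i. ascent h i = m \<or> ascent h i = m - 1 \<and> letter A B h (m - 1) = A"
proof (cases "h (m + 1) = h m")
  case True
  have "h (m - 1 + 1) = h m" "h (m - 1 + 2) = h (m + 1)" by (simp_all add: add.commute)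
  with True have "h m = h (m - 1) + 1" using h_step[of "m - 1"] two_step[of "m - 1"] by linarith
  then have "ascent h (h m) = m - 1" "letter A B h (m - 1) = A"
    by (auto intro!: ascent_eqI simp: letter_def)
  then show ?thesis by blast
next
  case False
  then have "ascent h (h m + 1) = m" using h_step[of m] by (intro ascent_eqI) auto
  then show ?thesis by blast
qed

text \<open>A window is completed to whole blocks \<open>A\<close> or \<open>A, B\<close> by at most one letter at each end.\<close>

lemma run_prod_window:
  assumes "m \<le> n" and det: "det A = 1" "det B = 1"
  obtains i j X where "i \<le> j" "real_of_int (j - i) \<le> x * (real_of_int (n - m) + 3)"
    "X = run_prod (letter (B ** A) A (derived h)) i (nat (j - i))"
    "run_prod (letter A B h) m (nat (n - m)) \<in>
       {X, X ** adj2 A, adj2 B ** X, adj2 B ** (X ** adj2 A)}"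
proof -
  let ?p = "run_prod (letter A B h)"
  obtain i where i: "ascent h i = m \<or> ascent h i = m - 1 \<and> letter A B h (m - 1) = A"
    using ascent_near[of m A B] by blast
  obtain j where j: "ascent h j = n \<or> ascent h j = n + 1 \<and> letter A B h n = B"
  proof (cases "h (n + 1) = h n")
    case True
    have "h (n + 1 + 1) = h (n + 2)" by (simp add: add.assoc)
    with True have "h (n + 2) = h (n + 1) + 1"
      using h_step[of "n + 1"] two_step[of n] by linarith
    then have "ascent h (h (n + 1) + 1) = n + 1" "letter A B h n = B"
      using True by (auto intro!: ascent_eqI simp: letter_def add.assoc)
    then show ?thesis using that by blast
  next
    case False
    then have "ascent h (h n + 1) = n" using h_step[of n] by (intro ascent_eqI) auto
    then show ?thesis using that by blast
  qed
  define X where "X = run_prod (letter (B ** A) A (derived h)) i (nat (j - i))"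
  have ij: "i \<le> j" using i j \<open>m \<le> n\<close> ascent_le_iff[of i j] by auto
  have X: "X = ?p (ascent h i) (nat (ascent h j - ascent h i))"
    unfolding X_def using run_prod_derived[OF ij] by simp
  have "?p m (nat (ascent h j - m)) \<in> {X, X ** adj2 A}"
    using i
  proof
    assume *: "ascent h i = m - 1 \<and> letter A B h (m - 1) = A"
    have "m \<le> ascent h j" using j \<open>m \<le> n\<close> by auto
    then have "X = ?p m (nat (ascent h j - m)) ** A"
      using run_prod_split[of "m - 1" m "ascent h j" "letter A B h"] * X by simp
    then have "X ** adj2 A = ?p m (nat (ascent h j - m)) ** (A ** adj2 A)"
      by (simp add: matrix_mul_assoc)
    then show ?thesis by (simp add: adj2_inverse[OF det(1)])
  qed (simp add: X)
  moreover have "?p m (nat (n - m)) \<in>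
      {?p m (nat (ascent h j - m)), adj2 B ** ?p m (nat (ascent h j - m))}"
    using j
  proof
    assume *: "ascent h j = n + 1 \<and> letter A B h n = B"
    then have "?p m (nat (ascent h j - m)) = B ** ?p m (nat (n - m))"
      using run_prod_split[of m n "n + 1" "letter A B h"] \<open>m \<le> n\<close> by simp
    then have "adj2 B ** ?p m (nat (ascent h j - m)) = (adj2 B ** B) ** ?p m (nat (n - m))"
      by (simp add: matrix_mul_assoc)
    then show ?thesis by (simp add: adj2_inverse[OF det(2)])
  qed simp
  ultimately have mem: "?p m (nat (n - m)) \<in> {X, X ** adj2 A, adj2 B ** X, adj2 B ** (X ** adj2 A)}"
    by auto
  \<comment> \<open>At most one letter is added at each end, which gives the 2;
    \<open>ascent_diff\<close> contributes a further \<open>x\<close>.\<close>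
  have "real_of_int (j - i) \<le> x * (real_of_int (n - m) + 3)"
  proof -
    have "real_of_int (ascent h j - ascent h i) \<le> real_of_int (n - m) + 2" using i j by linarith
    then have "real_of_int (ascent h j - ascent h i) * x \<le> (real_of_int (n - m) + 2) * x"
      using slope by (intro mult_right_mono) auto
    then show ?thesis using ascent_diff[of j i] by (simp add: algebra_simps)
  qed
  then show ?thesis using that[OF ij _ X_def mem] by blast
qed

end

section \<open>The Fibonacci hierarchy of transfer matrices\<close>

text \<open>
  The index is shifted by one: \<open>fibmat V E 1\<close> and \<open>fibmat V E 2\<close> are the one-step matrices of the
  two letters, and \<open>fibmat V E 0\<close> extends the recursion backwards.
\<close>

fun fibmat :: "real \<Rightarrow> complex \<Rightarrow> nat \<Rightarrow> complex^2^2" where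
  "fibmat V E 0 = mat2 1 (- of_real V) 0 1"
| "fibmat V E (Suc 0) = mat2 E (- 1) 1 0"
| "fibmat V E (Suc (Suc k)) = fibmat V E k ** fibmat V E (Suc k)"

abbreviation fibtr :: "real \<Rightarrow> complex \<Rightarrow> nat \<Rightarrow> complex" where
  "fibtr V E k \<equiv> trace (fibmat V E k)"

lemma fibmat_2: "fibmat V E 2 = mat2 (E - of_real V) (- 1) 1 0"
  by (rule mat2_eqI) (simp_all add: numeral_2_eq_2 mult2_nth)

lemma det_fibmat: "det (fibmat V E k) = 1"
  by (induction V E k rule: fibmat.induct) (simp_all add: det_mul, simp_all add: det_2)

lemma fibtr_0: "fibtr V E 0 = 2"
  and fibtr_1: "fibtr V E 1 = E"
  and fibtr_2: "fibtr V E 2 = E - of_real V"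
  unfolding fibmat_2 One_nat_def fibmat.simps by (simp_all add: trace2)

text \<open>The Fibonacci trace map, obtained as the trace of \<open>mult_ABA\<close>; the term
  \<open>mat (trace B)\<close> has trace \<open>2 * trace B\<close>, which turns
  \<open>+ trace B\<close> into \<open>- trace B\<close>.\<close>

lemma fibtr_Suc3: "fibtr V E (k + 3) = fibtr V E (k + 2) * fibtr V E (k + 1) - fibtr V E k"
proof -
  let ?A = "fibmat V E (k + 1)" and ?B = "fibmat V E k"
  have "fibmat V E (k + 3) = ?A ** (?B ** ?A)"
    by (simp add: numeral_3_eq_3)
  also have "\<dots> = mat (fibtr V E (k + 2)) ** ?A + ?B - mat (fibtr V E k)"
    by (subst mult_ABA) (simp_all add: det_fibmat)
  finally have "fibtr V E (k + 3)
      = trace (mat (fibtr V E (k + 2)) ** ?A + ?B - mat (fibtr V E k))" by (rule arg_cong)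
  also have "\<dots> = fibtr V E (k + 2) * trace ?A + trace ?B - 2 * fibtr V E k"
    unfolding trace2[of "_ - _"] trace2[of ?A] trace2[of ?B]
    by (simp add: mult2_nth mat_nth algebra_simps del: fibmat.simps)
  finally show ?thesis by simp
qed

text \<open>The Fricke-Vogt invariant, a conserved quantity of the trace map. Its value is read off
  from the initial traces \<open>2\<close>, \<open>E\<close>, \<open>E - V\<close>.\<close>

lemma fibtr_invariant:
  "(fibtr V E (k + 2))\<^sup>2 + (fibtr V E (k + 1))\<^sup>2 + (fibtr V E k)\<^sup>2
    - fibtr V E (k + 2) * fibtr V E (k + 1) * fibtr V E k = 4 + (of_real V)\<^sup>2"
proof (induction k)
  case 0
  show ?case unfolding add_0 fibtr_0 fibtr_1 fibtr_2
    by (simp add: power2_eq_square algebra_simps)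
next
  case (Suc k)
  have "fibtr V E (Suc k + 2) = fibtr V E (k + 2) * fibtr V E (k + 1) - fibtr V E k"
    using fibtr_Suc3[of V E k] by (simp add: numeral_3_eq_3)
  moreover have "fibtr V E (Suc k + 1) = fibtr V E (k + 2)" "fibtr V E (Suc k) = fibtr V E (k + 1)"
    by simp_all
  ultimately show ?case using Suc by algebra
qed

section \<open>Growth of products over windows\<close>

text \<open>A crude bound per letter, used only for the boundedly many letters at which the
  renormalisation stops. It rests on the multiplication table of the four basis words, whose entries
  are polynomials in the traces.\<close>

lemma span_box_letter_left:
  assumes det: "det A = 1" "det B = 1"
    and tr: "cmod (trace A) \<le> T" "cmod (trace B) \<le> T" "cmod (trace (B ** A)) \<le> T"
    and "T \<ge> 1" "S \<ge> 0" and X: "X \<in> span_box A B S S S S"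
  defines "R \<equiv> (1 + T)\<^sup>2 * S"
  shows "A ** X \<in> span_box A B R R R R" "B ** X \<in> span_box A B R R R R"
proof -
  from X obtain c0 c1 c2 c3 where
    X: "X = mat c0 + mat c1 ** B + mat c2 ** A + mat c3 ** (B ** A)"
    and c: "cmod c0 \<le> S" "cmod c1 \<le> S" "cmod c2 \<le> S" "cmod c3 \<le> S"
    unfolding span_box_def by blast
  have S: "T * S \<le> R" "S + T * S \<le> R" "S \<le> R" "S + 3 * (T * S) \<le> R" "S + 2 * (T * S) + T * T * S \<le> R"
  proof -
    have "R = S + 2 * (T * S) + T * (T * S)" by (simp add: R_def power2_eq_square algebra_simps)
    moreover have "T * S \<le> T * (T * S)" "0 \<le> T * S"
      using mult_right_mono[of 1 T "T * S"] \<open>T \<ge> 1\<close> \<open>S \<ge> 0\<close> by auto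
    ultimately show "T * S \<le> R" "S + T * S \<le> R" "S \<le> R" "S + 3 * (T * S) \<le> R"
      "S + 2 * (T * S) + T * T * S \<le> R"
      using \<open>S \<ge> 0\<close> unfolding mult.assoc by linarith+
  qed
  have tc: "cmod (t * c) \<le> T * S" if "cmod t \<le> T" "cmod c \<le> S" for t c
    using that by (simp add: norm_mult mult_mono')
  have AA: "A ** A = mat (trace A) ** A - mat 1" and BB: "B ** B = mat (trace B) ** B - mat 1"
    using det unfolding det_2 by (auto intro!: mat2_eqI simp: mat2_simps algebra_simps)
  \<comment> \<open>The polarised Cayley-Hamilton identity, which brings \<open>A B\<close> into the
    order \<open>B A\<close>.\<close>
  have AB: "A ** B = mat (trace A) ** B + mat (trace B) ** A - B ** A
      + mat (trace (B ** A) - trace A * trace B)"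
    by (rule mat2_eqI) (simp_all add: mat2_simps algebra_simps)
  have dist: "C ** X = mat c0 ** C + mat c1 ** (C ** B) + mat c2 ** (C ** A)
      + mat c3 ** (C ** (B ** A))" for C :: "complex^2^2"
    unfolding X by (rule mat2_eqI) (simp_all add: mult2_nth mat_nth algebra_simps)
  show "A ** X \<in> span_box A B R R R R"
  proof (rule span_boxI)
    show "A ** X = mat ((trace (B ** A) * c1 - trace A * (trace B * c1)) - c2 - trace B * c3)
        + mat (trace A * c1 + c3) ** B
        + mat (c0 + trace B * c1 + trace A * c2 + trace (B ** A) * c3) ** A
        + mat (- c1) ** (B ** A)"
      unfolding dist AB AA mult_ABA[OF det]
      by (rule mat2_eqI) (simp_all add: mult2_nth mat_nth algebra_simps)
    have "cmod (trace A * (trace B * c1)) \<le> T * (T * S)"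
      using tc[OF tr(2) c(2)] tr(1) unfolding norm_mult[of "trace A"] by (simp add: mult_mono')
    then have "cmod ((trace (B ** A) * c1 - trace A * (trace B * c1)) - c2 - trace B * c3)
        \<le> (T * S + T * (T * S)) + S + T * S"
      using norm_triangle_ineq4[of "trace (B ** A) * c1" "trace A * (trace B * c1)"]
        norm_triangle_ineq4[of "trace (B ** A) * c1 - trace A * (trace B * c1)" c2]
        norm_triangle_ineq4[of "trace (B ** A) * c1 - trace A * (trace B * c1) - c2" "trace B * c3"]
        tc[OF tr(3) c(2)] tc[OF tr(2) c(4)] c(3) by linarith
    then show "cmod ((trace (B ** A) * c1 - trace A * (trace B * c1)) - c2 - trace B * c3) \<le> R"
      using S(5) unfolding mult.assoc by linarith
    show "cmod (trace A * c1 + c3) \<le> R"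
      using norm_triangle_ineq[of "trace A * c1" c3] tc[OF tr(1) c(2)] c(4) S(2) by linarith
    have "cmod (c0 + trace B * c1 + trace A * c2 + trace (B ** A) * c3)
        \<le> S + T * S + T * S + T * S"
      by (intro order_trans[OF norm_triangle_ineq] add_mono tc tr c)
    then show "cmod (c0 + trace B * c1 + trace A * c2 + trace (B ** A) * c3) \<le> R"
      using S(4) by linarith
    show "cmod (- c1) \<le> R" using c S(3) by simp
  qed
  have BBA: "B ** (B ** A) = mat (trace B) ** (B ** A) - A"
    unfolding matrix_mul_assoc BB by (rule mat2_eqI) (simp_all add: mult2_nth mat_nth algebra_simps)
  show "B ** X \<in> span_box A B R R R R"
  proof (rule span_boxI)
    show "B ** X = mat (- c1) + mat (c0 + trace B * c1) ** B + mat (- c3) ** A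
        + mat (c2 + trace B * c3) ** (B ** A)"
      unfolding dist BBA BB
      by (rule mat2_eqI) (simp_all add: mult2_nth mat_nth algebra_simps)
    show "cmod (- c1) \<le> R" "cmod (- c3) \<le> R" using c S(3) by simp_all
    show "cmod (c0 + trace B * c1) \<le> R"
      using norm_triangle_ineq[of c0 "trace B * c1"] tc[OF tr(2) c(2)] c(1) S(2) by linarith
    show "cmod (c2 + trace B * c3) \<le> R"
      using norm_triangle_ineq[of c2 "trace B * c3"] tc[OF tr(2) c(4)] c(3) S(2) by linarith
  qed
qed

lemma growth_box_mono:
  assumes "X \<in> growth_box A B T S" "S \<le> S'" "T > 0"
  shows "X \<in> growth_box A B T S'"
  using assms(1) unfolding growth_box_def
  by (rule span_box_mono) (use assms in \<open>simp_all add: divide_right_mono\<close>)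

lemma run_prod_short:
  assumes det: "det A = 1" "det B = 1"
    and tr: "cmod (trace A) \<le> T" "cmod (trace B) \<le> T" "cmod (trace (B ** A)) \<le> T"
    and T: "T \<ge> 1"
  shows "run_prod (letter A B h) m k \<in> growth_box A B T (T\<^sup>2 * ((1 + T)\<^sup>2) ^ k)"
proof -
  define G where "G = (1 + T)\<^sup>2"
  have *: "run_prod (letter A B h) m k \<in> span_box A B (G ^ k) (G ^ k) (G ^ k) (G ^ k)"
  proof (induction k)
    case 0
    show ?case by (rule span_boxI[of _ 1 0 _ 0 _ 0]) simp_all
  next
    case (Suc k)
    have "G ^ k \<ge> 0" by (simp add: G_def)
    from span_box_letter_left[OF det tr T this Suc] show ?case
      by (simp add: letter_def G_def)
  qed
  \<comment> \<open>The factor \<open>T^2\<close> compensates for the smallest weight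
    \<open>1 / T^2\<close> in \<open>growth_box\<close>.\<close>
  have "G ^ k \<le> T\<^sup>2 * G ^ k" "G ^ k \<le> T\<^sup>2 * G ^ k / T" "G ^ k \<le> T\<^sup>2 * G ^ k / T\<^sup>2"
    using T mult_right_mono[of 1 "T\<^sup>2" "G ^ k", OF one_le_power] mult_right_mono[of 1 T "G ^ k"]
    by (simp_all add: G_def power2_eq_square)
  then show ?thesis unfolding growth_box_def G_def[symmetric] by (intro span_box_mono[OF *])
qed

section \<open>Iteration over the levels at slope \<alpha>\<close>

lemma alpha_bounds: "1/2 \<le> \<alpha>" "\<alpha> < 5/8" and alpha_sq: "\<alpha> * \<alpha> = 1 - \<alpha>" and inverse_alpha: "1 / \<alpha> = 1 + \<alpha>"
proof -
  have "2 \<le> sqrt 5" by (rule real_le_rsqrt) simp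
  moreover have "sqrt 5 < 9/4" by (rule real_less_lsqrt) (simp_all add: power2_eq_square)
  ultimately show b: "1/2 \<le> \<alpha>" "\<alpha> < 5/8" by (simp_all add: \<alpha>_def)
  show sq: "\<alpha> * \<alpha> = 1 - \<alpha>" by (simp add: \<alpha>_def field_simps)
  then show "1 / \<alpha> = 1 + \<alpha>" using b by (simp add: field_simps)
qed

text \<open>One level maps a length \<open>L\<close> to at most \<open>\<alpha> * (L + 3)\<close>.
  The fixed point of this map is \<open>3 / \<alpha>\<close>, so with that offset the power of
  \<open>1 / \<alpha>\<close> drops by exactly one. The function \<open>h\<close> is arbitrary
  because the derived word is only known to be balanced.\<close>

lemma run_prod_growth:
  assumes tr: "\<And>k. cmod (fibtr V E k) \<le> T" and T: "T \<ge> 2"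
    and "balanced \<alpha> h" "m \<le> n" "real_of_int (n - m) \<le> (1 / \<alpha>) ^ K + 3 / \<alpha>"
  shows "run_prod (letter (fibmat V E (k + 2)) (fibmat V E (k + 1)) h) m (nat (n - m))
    \<in> growth_box (fibmat V E (k + 2)) (fibmat V E (k + 1)) T
        (T\<^sup>2 * ((1 + T)\<^sup>2) ^ 5 * growth_rate T ^ K)"
  using assms(3-)
proof (induction K arbitrary: k h m n)
  case 0
  have "3 / \<alpha> = 3 * (1 + \<alpha>)" using inverse_alpha by simp
  \<comment> \<open>At level 0 at most five letters remain, whence the exponent 5 in the
    constant.\<close>
  then have "1 + 3 / \<alpha> < 6" using alpha_bounds by simp
  then have "n - m < 6" using 0 by simp
  then have "nat (n - m) \<le> 5" by simp
  then have "((1 + T)\<^sup>2) ^ nat (n - m) \<le> ((1 + T)\<^sup>2) ^ 5"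
    using T by (intro power_increasing) auto
  moreover have "cmod (trace (fibmat V E (k + 1) ** fibmat V E (k + 2))) \<le> T"
    using tr[of "k + 3"] by (simp add: numeral_3_eq_3)
  ultimately show ?case using T
    by (intro growth_box_mono[OF run_prod_short[OF det_fibmat det_fibmat tr tr]]) simp_all
next
  case (Suc K)
  interpret balanced_word \<alpha> h
    using alpha_bounds Suc.prems(1) by unfold_locales auto
  let ?A = "fibmat V E (k + 2)" and ?B = "fibmat V E (k + 1)"
  let ?S = "T\<^sup>2 * ((1 + T)\<^sup>2) ^ 5 * growth_rate T ^ K"
  have BA: "?B ** ?A = fibmat V E (Suc k + 2)" by (simp add: numeral_2_eq_2)
  have A: "?A = fibmat V E (Suc k + 1)" by simp
  obtain i j X where ij: "i \<le> j" "real_of_int (j - i) \<le> \<alpha> * (real_of_int (n - m) + 3)"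
    and X: "X = run_prod (letter (?B ** ?A) ?A (derived h)) i (nat (j - i))"
    and mem: "run_prod (letter ?A ?B h) m (nat (n - m)) \<in>
       {X, X ** adj2 ?A, adj2 ?B ** X, adj2 ?B ** (X ** adj2 ?A)}"
    using run_prod_window[OF Suc.prems(2), of ?A ?B] det_fibmat by metis
  have "\<alpha> * (real_of_int (n - m) + 3) \<le> \<alpha> * ((1 / \<alpha>) ^ Suc K + 3 / \<alpha> + 3)"
    using Suc.prems(3) alpha_bounds by (intro mult_left_mono) auto
  also have "\<dots> = (1 / \<alpha>) ^ K + 3 * (1 + \<alpha>)"
    using alpha_bounds by (simp add: field_simps)
  also have "\<dots> = (1 / \<alpha>) ^ K + 3 / \<alpha>" using inverse_alpha by simp
  finally have len: "real_of_int (j - i) \<le> (1 / \<alpha>) ^ K + 3 / \<alpha>" using ij(2) by linarith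
  have "balanced \<alpha> (derived h)" using balanced_derived inverse_alpha by simp
  from Suc.IH[OF this ij(1) len, of "Suc k"]
  have X_box: "X \<in> growth_box (?B ** ?A) ?A T ?S" unfolding X BA by (simp only: A)
  have tr_BA: "cmod (trace (?B ** ?A)) \<le> T" unfolding BA by (rule tr)
  have "0 \<le> ?S" using T by (simp add: growth_rate_def)
  note growth = growth_box_step[OF det_fibmat det_fibmat tr tr tr_BA T this X_box]
  have "run_prod (letter ?A ?B h) m (nat (n - m)) \<in> growth_box ?A ?B T (growth_rate T * ?S)"
    using mem growth by (elim insertE emptyE) (simp_all only:)
  then show ?case by (simp only: power_Suc mult_ac)
qed

lemma entry_norm_growth_box:
  assumes "X \<in> growth_box A B T S" "T \<ge> 1" "S \<ge> 0"
  shows "entry_norm X \<le> S * (2 + entry_norm B + entry_norm A + entry_norm B * entry_norm A)"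
proof -
  from assms(1) obtain c0 c1 c2 c3 where
    X: "X = mat c0 + mat c1 ** B + mat c2 ** A + mat c3 ** (B ** A)"
    and c: "cmod c0 \<le> S" "cmod c1 \<le> S / T" "cmod c2 \<le> S / T" "cmod c3 \<le> S / T\<^sup>2"
    unfolding growth_box_def span_box_def by blast
  have "S / T \<le> S" "S / T\<^sup>2 \<le> S"
    using assms(2,3) by (simp_all add: divide_le_eq mult_le_cancel_left1 one_le_power)
  with c have c: "cmod c0 \<le> S" "cmod c1 \<le> S" "cmod c2 \<le> S" "cmod c3 \<le> S" by linarith+
  have "entry_norm X \<le> entry_norm (mat c0) + entry_norm (mat c1 ** B) + entry_norm (mat c2 ** A)
      + entry_norm (mat c3 ** (B ** A))"
    unfolding X by (intro order_trans[OF entry_norm_add] add_mono order_refl)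
  also have "\<dots> \<le> S * 2 + S * entry_norm B + S * entry_norm A + S * (entry_norm B * entry_norm A)"
    unfolding entry_norm_scale using c entry_norm_mult[of B A]
    by (intro add_mono mult_mono) (simp_all add: entry_norm_nonneg entry_norm_def[of "mat _"] mat_nth assms)
  finally show ?thesis by (simp add: algebra_simps)
qed

section \<open>Transfer matrices as products over words\<close>

lemma run_prod_solution:
  assumes "\<And>i. g i = mat2 (q i) (- 1) 1 0" "\<And>i. u (i + 1) = q i * u i - u (i - 1)"
  shows "(vector [u (m + int k), u (m + int k - 1)] :: complex^2)
    = run_prod g m k *v vector [u m, u (m - 1)]"
proof (induction k)
  case (Suc k)
  have "(vector [u (m + int (Suc k)), u (m + int (Suc k) - 1)] :: complex^2)
      = g (m + int k) *v vector [u (m + int k), u (m + int k - 1)]"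
    using assms(2)[of "m + int k"]
    by (simp add: assms(1) vec_eq_iff forall_2 matrix_vector_mult_def sum_2 add_ac)
  then show ?case by (simp add: Suc matrix_vector_mul_assoc)
qed simp

definition fib_letter :: "real \<Rightarrow> complex \<Rightarrow> (int \<Rightarrow> int) \<Rightarrow> int \<Rightarrow> complex^2^2" where
  "fib_letter V E = letter (fibmat V E 2) (fibmat V E 1)"

definition fib_height :: "real \<Rightarrow> int \<Rightarrow> int" where
  "fib_height \<omega> n = \<lfloor>of_int n * \<alpha> + \<omega>\<rfloor>"

lemma balanced_floor: "balanced x (\<lambda>n. \<lfloor>of_int n * x + \<omega>\<rfloor>)"
  unfolding balanced_def
proof (intro allI)
  fix n m :: int
  show "\<bar>real_of_int (\<lfloor>of_int n * x + \<omega>\<rfloor> - \<lfloor>of_int m * x + \<omega>\<rfloor>) - real_of_int (n - m) * x\<bar> < 1"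
    using floor_correct[of "of_int n * x + \<omega>"] floor_correct[of "of_int m * x + \<omega>"]
    by (simp add: algebra_simps) linarith
qed

lemma balanced_fib_height: "balanced \<alpha> (fib_height \<omega>)"
  using balanced_floor[of \<alpha> \<omega>] by (simp add: fib_height_def[abs_def])

text \<open>Adding \<alpha> crosses an integer exactly when the fractional part is at least
  \<open>1 - \<alpha>\<close>, so the sites with potential \<open>V\<close> are the ascents of the
  height.\<close>

lemma fib_potential_height:
  "fib_potential V \<omega> n = (if fib_height \<omega> (n + 1) = fib_height \<omega> n then 0 else V)"
proof -
  define y where "y = of_int n * \<alpha> + \<omega>"
  have "fib_height \<omega> (n + 1) = \<lfloor>y + \<alpha>\<rfloor>" "fib_height \<omega> n = \<lfloor>y\<rfloor>"
    by (simp_all add: fib_height_def y_def algebra_simps)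
  moreover have "\<lfloor>y + \<alpha>\<rfloor> = \<lfloor>y\<rfloor> \<longleftrightarrow> frac y < 1 - \<alpha>"
    using alpha_bounds unfolding floor_eq_iff frac_def by linarith
  ultimately show ?thesis
    using frac_lt_1[of y] by (auto simp: fib_potential_def y_def[symmetric] indicator_def)
qed

lemma letter_one_step:
  "fib_letter V E h n = mat2 (E - of_real (if h (n + 1) = h n then 0 else V)) (- 1) 1 0"
  by (simp add: fib_letter_def letter_def fibmat_2)

lemma fib_letter_potential:
  "fib_letter V E (fib_height \<omega>) n = mat2 (E - of_real (fib_potential V \<omega> n)) (- 1) 1 0"
  by (simp add: letter_one_step fib_potential_height)

lemma fib_transfer_eqI: "is_transfer V n m \<omega> E A \<Longrightarrow> fib_transfer V n m \<omega> E = A"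
  using ex1_transfer is_transfer_fib_transfer by blast

text \<open>The step away from \<open>(u (m + 1), u m)\<close> uses the potential at
  \<open>m + 1\<close>; therefore the word starts there.\<close>

lemma run_prod_transfer:
  assumes "fib_solution V \<omega> E u" "m \<le> n"
  shows "(vector [u (n + 1), u n] :: complex^2)
    = run_prod (fib_letter V E (fib_height \<omega>)) (m + 1) (nat (n - m)) *v vector [u (m + 1), u m]"
proof -
  have "u (i + 1) = (E - of_real (fib_potential V \<omega> i)) * u i - u (i - 1)" for i
    using assms(1) unfolding fib_solution_alt by blast
  note run_prod_solution[where u = u and q = "\<lambda>i. E - of_real (fib_potential V \<omega> i)"
      and m = "m + 1" and k = "nat (n - m)", OF fib_letter_potential this]
  then show ?thesis using assms(2) by (simp add: add.commute)
qed

lemma fib_transfer_forward: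
  assumes "m \<le> n"
  shows "fib_transfer V n m \<omega> E = run_prod (fib_letter V E (fib_height \<omega>)) (m + 1) (nat (n - m))"
  by (rule fib_transfer_eqI) (use run_prod_transfer[OF _ assms] in \<open>auto simp: is_transfer_def\<close>)

lemma det_fib_letter: "det (fib_letter V E h n) = 1"
  by (simp add: letter_one_step det_2)

lemma fib_transfer_backward:
  assumes "m \<le> n"
  shows "fib_transfer V m n \<omega> E = adj2 (fib_transfer V n m \<omega> E)"
proof (rule fib_transfer_eqI)
  let ?A = "fib_transfer V n m \<omega> E"
  have "det ?A = 1"
    unfolding fib_transfer_forward[OF assms] by (intro det_run_prod det_fib_letter)
  then have "adj2 ?A *v (?A *v x) = x" for x
    by (simp add: matrix_vector_mul_assoc adj2_inverse)
  then show "is_transfer V m n \<omega> E (adj2 ?A)"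
    using is_transfer_fib_transfer[of V n m \<omega> E] by (simp add: is_transfer_def)
qed

lemma fib_transfer_growth:
  assumes tr: "\<And>k. cmod (fibtr V E k) \<le> T" and T: "T \<ge> 2"
    and len: "\<bar>real_of_int (n - m)\<bar> \<le> (1 / \<alpha>) ^ K"
  shows "opnorm (fib_transfer V n m \<omega> E)
    \<le> T\<^sup>2 * ((1 + T)\<^sup>2) ^ 5 * growth_rate T ^ K * (2 + (T + 2) + (T + 2) + (T + 2) * (T + 2))"
proof -
  let ?S = "T\<^sup>2 * ((1 + T)\<^sup>2) ^ 5 * growth_rate T ^ K"
  let ?A = "fibmat V E 2" and ?B = "fibmat V E 1"
  have S: "?S \<ge> 0" using T by (simp add: growth_rate_def)
  \<comment> \<open>\<open>E\<close> and \<open>E - V\<close> are themselves traces of the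
    hierarchy, so the trace bound also controls the bottom matrices.\<close>
  have AB: "entry_norm ?A \<le> T + 2" "entry_norm ?B \<le> T + 2"
    using tr[of 1] tr[of 2] unfolding fibtr_1 fibtr_2 by (simp_all add: fibmat_2 entry_norm_def)
  have main: "entry_norm (fib_transfer V n m \<omega> E)
      \<le> ?S * (2 + (T + 2) + (T + 2) + (T + 2) * (T + 2))"
    if "m \<le> n" "\<bar>real_of_int (n - m)\<bar> \<le> (1 / \<alpha>) ^ K" for n m
  proof -
    have "real_of_int (n - m) \<le> (1 / \<alpha>) ^ K + 3 / \<alpha>"
      using that alpha_bounds by (simp add: add_increasing2)
    moreover have "m + 1 \<le> n + 1" using that by simp
    ultimately have "run_prod (fib_letter V E (fib_height \<omega>)) (m + 1) (nat (n - m))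
        \<in> growth_box ?A ?B T ?S"
      using run_prod_growth[OF tr T balanced_fib_height, where k = 0 and m = "m + 1" and n = "n + 1",
          unfolded add_0 add_diff_cancel_right, folded fib_letter_def] by blast
    then have "fib_transfer V n m \<omega> E \<in> growth_box ?A ?B T ?S"
      using that by (simp add: fib_transfer_forward)
    then have "entry_norm (fib_transfer V n m \<omega> E)
        \<le> ?S * (2 + entry_norm ?B + entry_norm ?A + entry_norm ?B * entry_norm ?A)"
      using T S by (intro entry_norm_growth_box) auto
    also have "\<dots> \<le> ?S * (2 + (T + 2) + (T + 2) + (T + 2) * (T + 2))"
      using AB T S by (intro mult_left_mono add_mono mult_mono entry_norm_nonneg) auto
    finally show ?thesis .
  qed
  have "entry_norm (fib_transfer V n m \<omega> E) \<le> ?S * (2 + (T + 2) + (T + 2) + (T + 2) * (T + 2))"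
  proof (cases "m \<le> n")
    case False
    then have "entry_norm (fib_transfer V n m \<omega> E) = entry_norm (fib_transfer V m n \<omega> E)"
      by (simp add: fib_transfer_backward entry_norm_adj2)
    then show ?thesis using main[of n m] False len by (simp add: abs_minus_commute)
  qed (use main len in blast)
  then show ?thesis using opnorm_le_entry_norm order_trans by blast
qed

section \<open>The trace map\<close>

lemma trace_step_induct [case_names 0 1 2 Suc3]:
  assumes "P 0" "P 1" "P 2" "\<And>k. P k \<Longrightarrow> P (k + 1) \<Longrightarrow> P (k + 2) \<Longrightarrow> P (k + 3)"
  shows "P (k :: nat)"
proof -
  have "P k \<and> P (k + 1) \<and> P (k + 2)"
    by (induction k) (use assms in \<open>auto simp: numeral_eq_Suc\<close>)
  then show ?thesis by simp
qed

lemma fibtr_real: "fibtr V (of_real x) k \<in> \<real>"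
  by (induction k rule: trace_step_induct)
    (simp_all only: fibtr_0 fibtr_1 fibtr_2 fibtr_Suc3, auto)

lemma continuous_fibtr: "continuous_on UNIV (\<lambda>E. fibtr V E k)"
  by (induction k rule: trace_step_induct)
    (simp_all only: fibtr_0 fibtr_1 fibtr_2 fibtr_Suc3, auto intro!: continuous_intros)

text \<open>Completing the square in \<open>x\<close> gives
  \<open>(2 x - y z)^2 = (4 - y^2) (4 - z^2) + 4 V^2\<close>, and the first summand is at most
  \<open>(4 - \<bar>y z\<bar>)^2\<close>.\<close>

lemma trace_invariant_bound:
  fixes x y z V :: real
  assumes inv: "x\<^sup>2 + y\<^sup>2 + z\<^sup>2 - x * y * z = 4 + V\<^sup>2" and "\<bar>y\<bar> \<le> 2" "\<bar>z\<bar> \<le> 2" "V \<ge> 0"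
  shows "\<bar>x\<bar> \<le> 2 + V"
proof -
  define w where "w = \<bar>y * z\<bar>"
  have w: "0 \<le> w" "w \<le> 4"
    using mult_mono[OF assms(2,3)] by (simp_all add: w_def abs_mult)
  have w2: "w\<^sup>2 = y\<^sup>2 * z\<^sup>2" by (simp add: w_def power_mult_distrib)
  have "0 \<le> (\<bar>y\<bar> - \<bar>z\<bar>)\<^sup>2" by simp
  then have "2 * w \<le> y\<^sup>2 + z\<^sup>2" by (simp add: w_def abs_mult power2_eq_square algebra_simps)
  moreover have "(2 * x - y * z)\<^sup>2 = 4 * (4 + V\<^sup>2) - 4 * y\<^sup>2 - 4 * z\<^sup>2 + y\<^sup>2 * z\<^sup>2"
    unfolding inv[symmetric] by (simp add: power2_eq_square algebra_simps)
  ultimately have "(2 * x - y * z)\<^sup>2 \<le> (4 - w)\<^sup>2 + (2 * V)\<^sup>2"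
    using w2 by (simp add: power2_eq_square algebra_simps)
  also have "\<dots> \<le> (4 - w + 2 * V)\<^sup>2"
    using w \<open>V \<ge> 0\<close> by (simp add: power2_sum)
  finally have "\<bar>2 * x - y * z\<bar> \<le> 4 - w + 2 * V"
    using w \<open>V \<ge> 0\<close> by (simp add: abs_le_square_iff[symmetric])
  then show ?thesis unfolding w_def by linarith
qed

text \<open>A trace above 2 has both neighbours at most 2. The invariant is symmetric in the three
  traces, so the middle one can take the place of \<open>x\<close> in
  \<open>trace_invariant_bound\<close>.\<close>

lemma fibtr_bounded:
  assumes nonesc: "\<And>k. \<not> (cmod (fibtr V E k) > 2 \<and> cmod (fibtr V E (k + 1)) > 2)"
    and "E \<in> \<real>" "V \<ge> 0"
  shows "cmod (fibtr V E k) \<le> 2 + V"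
proof (cases "cmod (fibtr V E k) > 2")
  case True
  define r where "r j = Re (fibtr V E j)" for j
  have r: "fibtr V E j = of_real (r j)" for j
    using fibtr_real[of V _ j] \<open>E \<in> \<real>\<close> by (auto simp: r_def elim!: Reals_cases)
  have inv: "(r (j + 2))\<^sup>2 + (r (j + 1))\<^sup>2 + (r j)\<^sup>2 - r (j + 2) * r (j + 1) * r j = 4 + V\<^sup>2" for j
  proof -
    have "complex_of_real ((r (j + 2))\<^sup>2 + (r (j + 1))\<^sup>2 + (r j)\<^sup>2 - r (j + 2) * r (j + 1) * r j)
        = of_real (4 + V\<^sup>2)"
      using fibtr_invariant[of V E j] unfolding r by simp
    then show ?thesis unfolding of_real_eq_iff .
  qed
  have "k \<noteq> 0" using True fibtr_0[of V E] by (metis less_irrefl norm_numeral)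
  then obtain j where j: "k = j + 1" by (metis Suc_eq_plus1 not0_implies_Suc)
  have "\<bar>r j\<bar> \<le> 2" "\<bar>r (j + 2)\<bar> \<le> 2"
    using nonesc[of j] nonesc[of k] True unfolding j r by (simp_all add: add.assoc)
  moreover have "(r (j + 1))\<^sup>2 + (r (j + 2))\<^sup>2 + (r j)\<^sup>2 - r (j + 1) * r (j + 2) * r j = 4 + V\<^sup>2"
    using inv[of j] by (simp add: algebra_simps)
  ultimately have "\<bar>r (j + 1)\<bar> \<le> 2 + V"
    using trace_invariant_bound \<open>V \<ge> 0\<close> by blast
  then show ?thesis unfolding j r by simp
qed (use \<open>V \<ge> 0\<close> in simp)

text \<open>The comparison of \<open>s (j + 2)\<close> with \<open>s j\<close> keeps the subtracted
  term of the trace map small enough for the product to win. The four starting conditions are strict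
  so that they define an open set of energies.\<close>

lemma fibtr_escape:
  assumes "cmod (fibtr V E k) > 2" "cmod (fibtr V E (k + 1)) > 2" "cmod (fibtr V E (k + 2)) > 2"
    and "cmod (fibtr V E (k + 2)) > cmod (fibtr V E k)" and "j \<ge> k"
  shows "cmod (fibtr V E j) > 2"
proof -
  define s where "s j = cmod (fibtr V E j)" for j
  have "s j > 2 \<and> s (j + 1) > 2 \<and> s (j + 2) > 2 \<and> s (j + 2) \<ge> s j"
    using \<open>j \<ge> k\<close>
  proof (induction j rule: dec_induct)
    case base
    then show ?case using assms by (simp add: s_def del: fibmat.simps)
  next
    case (step j)
    have "s (j + 3) \<ge> s (j + 2) * s (j + 1) - s j"
      using norm_triangle_ineq2[of "fibtr V E (j + 2) * fibtr V E (j + 1)" "fibtr V E j"]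
      unfolding s_def fibtr_Suc3 norm_mult .
    \<comment> \<open>The first bound yields \<open>s (j + 3) \<ge> s (j + 2)\<close>; the second
      yields \<open>s (j + 3) \<ge> 2 * s (j + 1) - 2\<close>, hence
      \<open>s (j + 3) \<ge> s (j + 1)\<close>.\<close>
    moreover have "s (j + 2) * s (j + 1) \<ge> s (j + 2) * 2"
      "(s (j + 2) - 2) * (s (j + 1) - 1) \<ge> 0"
      using step.IH by (intro mult_left_mono mult_nonneg_nonneg; linarith)+
    moreover have "(s (j + 2) - 2) * (s (j + 1) - 1)
        = s (j + 2) * s (j + 1) - s (j + 2) - 2 * s (j + 1) + 2"
      by algebra
    ultimately have "s (j + 3) \<ge> s (j + 2)" "s (j + 3) \<ge> s (j + 1)"
      using step.IH by linarith+
    then show ?case using step.IH by (simp add: numeral_eq_Suc)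
  qed
  then show ?thesis by (simp add: s_def)
qed

text \<open>At the first pair of consecutive traces above 2 the preceding trace is at most 2, and
  this forces the next one above both 2 and the first of the pair. A preceding trace exists because
  the trace at index 0 is 2.\<close>

lemma fibtr_escape_open:
  assumes "cmod (fibtr V E k) > 2" "cmod (fibtr V E (k + 1)) > 2"
  obtains k0 \<delta> where "\<delta> > 0" "\<And>E' j. cmod (E' - E) < \<delta> \<Longrightarrow> j \<ge> k0 \<Longrightarrow> cmod (fibtr V E' j) > 2"
proof -
  define k0 where "k0 = (LEAST k. cmod (fibtr V E k) > 2 \<and> cmod (fibtr V E (k + 1)) > 2)"
  have k0: "cmod (fibtr V E k0) > 2 \<and> cmod (fibtr V E (k0 + 1)) > 2"
    unfolding k0_def by (rule LeastI[where P = "\<lambda>k. cmod (fibtr V E k) > 2 \<and> cmod (fibtr V E (k + 1)) > 2"])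
      (use assms in blast)
  then have "k0 \<noteq> 0" using fibtr_0[of V E] by (metis less_irrefl norm_numeral)
  then obtain i where i: "k0 = i + 1" by (metis Suc_eq_plus1 not0_implies_Suc)
  have "\<not> (cmod (fibtr V E i) > 2 \<and> cmod (fibtr V E (i + 1)) > 2)"
    using not_less_Least[of i "\<lambda>k. cmod (fibtr V E k) > 2 \<and> cmod (fibtr V E (k + 1)) > 2"] i
    unfolding k0_def by linarith
  then have "cmod (fibtr V E i) \<le> 2" using k0 i by auto
  define a b where "a = cmod (fibtr V E k0)" and "b = cmod (fibtr V E (k0 + 1))"
  have ab: "a > 2" "b > 2" using k0 by (simp_all add: a_def b_def)
  have "cmod (fibtr V E (k0 + 2)) \<ge> b * a - cmod (fibtr V E i)"
    using norm_triangle_ineq2[of "fibtr V E (i + 2) * fibtr V E (i + 1)" "fibtr V E i"]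
      fibtr_Suc3[of V E i]
    by (simp add: a_def b_def i norm_mult numeral_eq_Suc del: fibmat.simps)
  moreover have "(a - 2) * (b - 1) > 0" using ab by simp
  moreover have "(a - 2) * (b - 1) = b * a - a - 2 * b + 2" by algebra
  ultimately have grow: "cmod (fibtr V E (k0 + 2)) > a" "cmod (fibtr V E (k0 + 2)) > 2"
    using ab \<open>cmod (fibtr V E i) \<le> 2\<close> by linarith+
  define U where "U = {E. cmod (fibtr V E k0) > 2 \<and> cmod (fibtr V E (k0 + 1)) > 2
      \<and> cmod (fibtr V E (k0 + 2)) > 2 \<and> cmod (fibtr V E (k0 + 2)) > cmod (fibtr V E k0)}"
  have "open U" unfolding U_def
    by (intro open_Collect_conj open_Collect_less continuous_on_norm continuous_fibtr continuous_on_const)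
  moreover have "E \<in> U" using k0 grow by (simp add: U_def a_def del: fibmat.simps)
  ultimately obtain \<delta> where "\<delta> > 0" "ball E \<delta> \<subseteq> U" by (meson open_contains_ball)
  then have "cmod (E' - E) < \<delta> \<Longrightarrow> E' \<in> U" for E' by (auto simp: dist_norm norm_minus_commute)
  then show ?thesis
    using that[OF \<open>\<delta> > 0\<close>, of k0] fibtr_escape unfolding U_def by blast
qed

section \<open>Periodic approximants\<close>

lemma fib_ratio_bounds: "1/2 \<le> real (fib (n + 1)) / real (fib (n + 2))"
  "real (fib (n + 1)) / real (fib (n + 2)) \<le> 1"
proof -
  have "real (fib (n + 2)) = real (fib (n + 1)) + real (fib n)" "real (fib n) \<le> real (fib (n + 1))"
    using fib_plus_2[of n] fib_Suc_mono[of n] by simp_all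
  moreover have "0 < real (fib (n + 2))" using fib_neq_0_nat[of "n + 2"] by linarith
  ultimately show "1/2 \<le> real (fib (n + 1)) / real (fib (n + 2))"
    "real (fib (n + 1)) / real (fib (n + 2)) \<le> 1"
    by (simp_all add: le_divide_eq divide_le_eq del: fib.simps)
qed

text \<open>Deriving turns a period of \<open>fib (j + 3)\<close> letters with
  \<open>fib (j + 2)\<close> ascents into one of \<open>fib (j + 2)\<close> letters with
  \<open>fib (j + 1)\<close> ascents. A window may start inside a block, which cyclic invariance of
  the trace repairs. In the end the word is constantly \<open>A\<close>.\<close>

lemma trace_periodic_word:
  assumes "balanced (real (fib (j + 1)) / real (fib (j + 2))) h"
    and "\<And>n. h (n + int (fib (j + 2))) = h n + int (fib (j + 1))"
  shows "trace (run_prod (letter (fibmat V E (k + 2)) (fibmat V E (k + 1)) h) m (fib (j + 2)))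
    = fibtr V E (k + j + 2)"
  using assms
proof (induction j arbitrary: h k m)
  case 0
  have "h (m + 1) \<noteq> h m" using 0(2)[of m] by simp
  then show ?case by (simp add: letter_def)
next
  case (Suc j)
  let ?p = "fib (j + 2)" and ?q = "fib (j + 3)"
  let ?A = "fibmat V E (k + 2)" and ?B = "fibmat V E (k + 1)"
  let ?f = "letter ?A ?B h"
  have pos: "0 < ?p" by (rule fib_neq_0_nat) simp
  have q: "?q = ?p + fib (j + 1)" using fib_plus_2[of "j + 1"] by (simp add: numeral_eq_Suc)
  have h: "balanced (real ?p / real ?q) h" "h (n + int ?q) = h n + int ?p" for n
    using Suc.prems by (simp_all add: numeral_eq_Suc)
  interpret balanced_word "real ?p / real ?q" h
    using h fib_ratio_bounds[of "j + 1"] by unfold_locales (simp_all add: numeral_eq_Suc)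
  have asc: "ascent h (i + int ?p) = ascent h i + int ?q" for i
  proof (rule ascent_eqI)
    show "h (ascent h i + int ?q) = i + int ?p - 1" by (simp add: h(2) ascent)
    have "h (ascent h i + int ?q + 1) = h (ascent h i + 1 + int ?q)" by (simp add: add_ac)
    then show "h (ascent h i + int ?q + 1) = i + int ?p" by (simp only: h(2) ascent)
  qed
  have "1 / (a / (a + c)) - 1 = c / a" if "a > 0" for a c :: real
    using that by (simp add: field_simps)
  from this[of "real ?p" "real (fib (j + 1))"]
  have "1 / (real ?p / real ?q) - 1 = real (fib (j + 1)) / real ?p"
    using pos unfolding q of_nat_add by (simp del: fib.simps)
  then have bal: "balanced (real (fib (j + 1)) / real ?p) (derived h)"
    using balanced_derived by simp
  have per: "derived h (n + int ?p) = derived h n + int (fib (j + 1))" for n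
    using asc q by (simp add: derived_def)
  obtain i where i: "ascent h i = m \<or> ascent h i = m - 1 \<and> ?f (m - 1) = ?A"
    using ascent_near[of m ?A ?B] by blast
  have BA: "?B ** ?A = fibmat V E (Suc k + 2)" by (simp add: numeral_2_eq_2)
  have A: "?A = fibmat V E (Suc k + 1)" by simp
  have "run_prod ?f (ascent h i) ?q
      = run_prod (letter (?B ** ?A) ?A (derived h)) i ?p"
    using run_prod_derived[of i "i + int ?p" ?A ?B] unfolding asc
    by (simp del: fib.simps fibmat.simps)
  then have "trace (run_prod ?f (ascent h i) ?q) = fibtr V E (Suc k + j + 2)"
    using Suc.IH[OF bal per, of "Suc k" i] unfolding BA by (simp only: A)
  moreover have "trace (run_prod ?f m ?q) = trace (run_prod ?f (ascent h i) ?q)"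
    using i
  proof
    assume "ascent h i = m - 1 \<and> ?f (m - 1) = ?A"
    moreover have "h (m - 1 + int ?q + 1) = h (m - 1 + 1 + int ?q)" by (simp add: add_ac)
    then have "?f (m - 1 + int ?q) = ?f (m - 1)"
      unfolding letter_def by (simp only: h(2) add_right_cancel)
    from trace_run_prod_shift[OF this] show ?thesis using calculation by simp
  qed simp
  ultimately show ?case by (simp add: numeral_eq_Suc)
qed

section \<open>Fibonacci quotients as approximations of \<alpha>\<close>

lemma fib_alpha: "real (fib n) - \<alpha> * real (fib (n + 1)) = (- \<alpha>) ^ (n + 1)"
proof (induction n)
  case (Suc n)
  have "real (fib (Suc n)) - \<alpha> * real (fib (Suc n + 1))
      = (1 - \<alpha>) * real (fib (n + 1)) - \<alpha> * real (fib n)"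
    by (simp add: algebra_simps)
  also have "\<dots> = - \<alpha> * (real (fib n) - \<alpha> * real (fib (n + 1)))"
    unfolding alpha_sq[symmetric] by (simp add: algebra_simps)
  finally show ?case unfolding Suc by simp
qed simp

lemma fib_ratio_tendsto: "(\<lambda>n. real (fib (n + 1)) / real (fib (n + 2))) \<longlonglongrightarrow> \<alpha>"
proof (rule LIM_zero_cancel, rule Lim_null_comparison)
  show "\<forall>\<^sub>F n in sequentially.
      norm (real (fib (n + 1)) / real (fib (n + 2)) - \<alpha>) \<le> \<alpha> ^ (n + 2)"
  proof (rule always_eventually, rule allI)
    fix n
    have pos: "1 \<le> real (fib (n + 2))" using fib_neq_0_nat[of "n + 2"] by linarith
    then have "real (fib (n + 1)) / real (fib (n + 2)) - \<alpha>
        = (real (fib (n + 1)) - \<alpha> * real (fib (n + 1 + 1))) / real (fib (n + 2))"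
      by (simp add: field_simps)
    also have "\<dots> = (- \<alpha>) ^ (n + 2) / real (fib (n + 2))" unfolding fib_alpha by simp
    also have "norm \<dots> = \<alpha> ^ (n + 2) / real (fib (n + 2))"
      unfolding norm_divide norm_power norm_minus_cancel using alpha_bounds by simp
    also have "\<dots> \<le> \<alpha> ^ (n + 2)"
      using pos alpha_bounds mult_left_mono[OF pos, of "\<alpha> ^ (n + 2)"] by (simp add: divide_le_eq)
    finally show "norm (real (fib (n + 1)) / real (fib (n + 2)) - \<alpha>) \<le> \<alpha> ^ (n + 2)" .
  qed
  have "(\<lambda>n. \<alpha> ^ n) \<longlonglongrightarrow> 0" using alpha_bounds by (intro LIMSEQ_power_zero) simp
  then show "(\<lambda>n. \<alpha> ^ (n + 2)) \<longlonglongrightarrow> 0" by (rule LIMSEQ_ignore_initial_segment)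
qed

lemma le_fib_Suc: "n \<le> fib (n + 1)"
proof (induction n)
  case (Suc n)
  show ?case
  proof (cases "n = 0")
    case False
    then have "fib n > 0" by (rule fib_neq_0_nat[OF neq0_conv[THEN iffD1]])
    then show ?thesis using Suc by simp
  qed simp
qed simp

text \<open>The floor is continuous only from the right. Raising the phase by \<eta> makes the total
  displacement nonnegative, whatever the sign of the slope error, and so keeps all heights in the
  window.\<close>

lemma periodic_approximant:
  fixes M k0 :: nat
  obtains j h where "j \<ge> k0" "fib (j + 2) \<ge> M"
    "balanced (real (fib (j + 1)) / real (fib (j + 2))) h"
    "\<And>n. h (n + int (fib (j + 2))) = h n + int (fib (j + 1))"
    "\<And>n. 0 \<le> n \<Longrightarrow> n \<le> int M \<Longrightarrow> h n = fib_height \<omega> n"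
proof -
  define y where "y n = of_int n * \<alpha> + \<omega>" for n :: int
  \<comment> \<open>A quarter of the least distance to the next integer: the displacement is at most
    \<open>2 * \<eta>\<close> and must stay strictly below that distance.\<close>
  define \<eta> where "\<eta> = Min ((\<lambda>n. (of_int \<lfloor>y n\<rfloor> + 1 - y n) / 4) ` {0..int M})"
  have "y n < of_int \<lfloor>y n\<rfloor> + 1" for n by linarith
  then have "\<eta> > 0" unfolding \<eta>_def by (subst Min_gr_iff) auto
  have \<eta>: "y n + 2 * \<eta> < of_int \<lfloor>y n\<rfloor> + 1" if "n \<in> {0..int M}" for n
  proof -
    define d where "d = of_int \<lfloor>y n\<rfloor> + 1 - y n"
    have "\<eta> \<le> d / 4" unfolding \<eta>_def d_def using that by (intro Min_le) auto
    moreover have "0 < d" unfolding d_def by linarith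
    ultimately have "2 * \<eta> < d" by linarith
    then show ?thesis by (simp add: d_def)
  qed
  have "\<forall>\<^sub>F n in sequentially. \<bar>real (fib (n + 1)) / real (fib (n + 2)) - \<alpha>\<bar> < \<eta> / (real M + 1)"
    using tendstoD[OF fib_ratio_tendsto, of "\<eta> / (real M + 1)"] \<open>\<eta> > 0\<close> by (simp add: dist_real_def)
  then obtain N where N: "\<And>n. n \<ge> N \<Longrightarrow>
      \<bar>real (fib (n + 1)) / real (fib (n + 2)) - \<alpha>\<bar> < \<eta> / (real M + 1)"
    unfolding eventually_sequentially by blast
  define j where "j = max N (max k0 M)"
  define x where "x = real (fib (j + 1)) / real (fib (j + 2))"
  have x: "\<bar>x - \<alpha>\<bar> < \<eta> / (real M + 1)" using N[of j] by (simp add: x_def j_def)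
  define h where "h n = \<lfloor>of_int n * x + (\<omega> + \<eta>)\<rfloor>" for n :: int
  have "j \<ge> k0" by (simp add: j_def)
  moreover have "j \<ge> M" by (simp add: j_def)
  then have "fib (j + 2) \<ge> M" using le_fib_Suc[of "j + 1"] by (simp del: fib.simps)
  moreover have "balanced x h" unfolding h_def using balanced_floor[of x "\<omega> + \<eta>"] by simp
  moreover have "h (n + int (fib (j + 2))) = h n + int (fib (j + 1))" for n
  proof -
    have "real (fib (j + 2)) > 0" using fib_neq_0_nat[of "j + 2"] by linarith
    then have "of_int (n + int (fib (j + 2))) * x + (\<omega> + \<eta>)
        = of_int n * x + (\<omega> + \<eta>) + of_int (int (fib (j + 1)))"
      unfolding x_def by (simp add: field_simps)
    then show ?thesis unfolding h_def by (simp only: floor_add_int[symmetric])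
  qed
  moreover have "h n = fib_height \<omega> n" if "0 \<le> n" "n \<le> int M" for n
  proof -
    have "\<bar>of_int n * (x - \<alpha>)\<bar> \<le> real M * (\<eta> / (real M + 1))"
      unfolding abs_mult using that x by (intro mult_mono) auto
    also have "\<dots> \<le> \<eta>" using \<open>\<eta> > 0\<close> by (simp add: field_simps)
    finally have "\<bar>of_int n * (x - \<alpha>)\<bar> \<le> \<eta>" .
    moreover have "of_int n * x + (\<omega> + \<eta>) = y n + of_int n * (x - \<alpha>) + \<eta>"
      by (simp add: y_def algebra_simps)
    ultimately have "y n \<le> of_int n * x + (\<omega> + \<eta>)" "of_int n * x + (\<omega> + \<eta>) \<le> y n + 2 * \<eta>"
      by linarith+
    then have "\<lfloor>of_int n * x + (\<omega> + \<eta>)\<rfloor> = \<lfloor>y n\<rfloor>"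
      using \<eta>[of n] that by (intro floor_unique) (auto, linarith)
    then show ?thesis by (simp add: h_def fib_height_def y_def)
  qed
  ultimately show ?thesis using that[of j h] unfolding x_def by blast
qed

section \<open>A lower bound for symmetric matrices\<close>

lemma linear_coefficient_zero:
  fixes a b :: real
  assumes "\<And>t. 0 \<le> a * t\<^sup>2 + 2 * b * t"
  shows "b = 0"
proof (rule ccontr)
  assume "b \<noteq> 0"
  define c where "c = \<bar>a\<bar> + 1"
  have c: "c > 0" "a < c" by (simp_all add: c_def)
  have "a * (- b / c)\<^sup>2 + 2 * b * (- b / c) = b\<^sup>2 * (a - 2 * c) / c\<^sup>2"
    using c by (simp add: field_simps power2_eq_square)
  moreover have "b\<^sup>2 * (a - 2 * c) / c\<^sup>2 < 0"
    using c \<open>b \<noteq> 0\<close> by (intro divide_neg_pos mult_pos_neg) auto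
  ultimately show False using assms[of "- b / c"] by linarith
qed

text \<open>
  At a minimizer \<open>\<psi>\<close> of \<open>\<parallel>B \<psi>\<parallel>\<^sup>2\<close> on the unit sphere, with minimum \<open>s\<^sup>2\<close>, one has
  \<open>(B - s) (B + s) \<psi> = 0\<close>, so \<open>s\<close> or \<open>- s\<close> is an eigenvalue.
\<close>

lemma symmetric_lower_bound:
  fixes b :: "'a \<Rightarrow> 'a \<Rightarrow> real" and I :: "'a set"
  defines "B \<equiv> \<lambda>\<psi> i. \<Sum>j\<in>I. b i j * \<psi> j"
  assumes fin: "finite I" and sym: "\<And>i j. i \<in> I \<Longrightarrow> j \<in> I \<Longrightarrow> b i j = b j i"
    and eig: "\<And>s \<psi>. \<bar>s\<bar> < \<delta> \<Longrightarrow> \<forall>i\<in>I. B \<psi> i = s * \<psi> i \<Longrightarrow> \<forall>i\<in>I. \<psi> i = 0"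
    and "\<delta> \<ge> 0"
  shows "\<delta>\<^sup>2 * (\<Sum>i\<in>I. (\<psi> i)\<^sup>2) \<le> (\<Sum>i\<in>I. (B \<psi> i)\<^sup>2)"
proof (cases "\<forall>i\<in>I. \<psi> i = 0")
  case True
  then show ?thesis by (simp add: sum_nonneg)
next
  case nz: False
  define ip where "ip \<phi> \<theta> = (\<Sum>i\<in>I. \<phi> i * \<theta> i)" for \<phi> \<theta> :: "'a \<Rightarrow> real"
  have ip_B: "ip (B \<phi>) \<theta> = ip \<phi> (B \<theta>)" for \<phi> \<theta>
  proof -
    have "ip (B \<phi>) \<theta> = (\<Sum>i\<in>I. \<Sum>j\<in>I. b i j * \<phi> j * \<theta> i)"
      by (simp add: ip_def B_def sum_distrib_right)
    also have "\<dots> = (\<Sum>j\<in>I. \<Sum>i\<in>I. b i j * \<phi> j * \<theta> i)" by (rule sum.swap)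
    also have "\<dots> = ip \<phi> (B \<theta>)"
      unfolding ip_def B_def sum_distrib_left
      by (intro sum.cong refl) (simp add: sym)
    finally show ?thesis .
  qed
  have ip_lin: "ip (\<lambda>i. \<phi> i + t * \<theta> i) (\<lambda>i. \<phi> i + t * \<theta> i)
      = ip \<phi> \<phi> + 2 * ip \<phi> \<theta> * t + ip \<theta> \<theta> * t\<^sup>2" for \<phi> \<theta> t
    by (simp add: ip_def sum.distrib[symmetric] sum_distrib_left sum_distrib_right
        power2_eq_square algebra_simps)
  have B_lin: "B (\<lambda>i. \<phi> i + t * \<theta> i) = (\<lambda>i. B \<phi> i + t * B \<theta> i)" for \<phi> \<theta> t
    by (simp add: B_def sum.distrib sum_distrib_left algebra_simps)
  have ip_sq: "ip \<phi> \<phi> = (\<Sum>i\<in>I. (\<phi> i)\<^sup>2)" for \<phi> by (simp add: ip_def power2_eq_square)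
  have ip0: "ip \<phi> \<phi> = 0 \<longleftrightarrow> (\<forall>i\<in>I. \<phi> i = 0)" for \<phi>
    unfolding ip_sq using fin by (simp add: sum_nonneg_eq_0_iff)
  \<comment> \<open>Extension by 0 outside \<open>I\<close> places the unit sphere over
    \<open>I\<close> in a product of compact sets, which is compact by Tychonoff's theorem.\<close>
  define cube :: "('a \<Rightarrow> real) set" where
    "cube = PiE UNIV (\<lambda>i. if i \<in> I then {- 1..1} else {0})"
  have cube: "compact cube"
  proof -
    have "compactin (product_topology (\<lambda>i::'a. euclidean) UNIV) cube"
      unfolding cube_def compactin_PiE by simp
    then show ?thesis by (simp add: euclidean_product_topology)
  qed
  define S where "S = cube \<inter> {\<phi>. ip \<phi> \<phi> = 1}"
  have cont: "continuous_on UNIV (\<lambda>\<phi>. ip \<phi> \<phi>)" "continuous_on UNIV (\<lambda>\<phi>. ip (B \<phi>) (B \<phi>))"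
    unfolding ip_def B_def
    by (intro continuous_intros continuous_on_product_coordinates)+
  have "compact S"
    unfolding S_def by (intro compact_Int_closed cube closed_Collect_eq cont continuous_on_const)
  have normalize: "(\<lambda>i. if i \<in> I then \<phi> i / sqrt (ip \<phi> \<phi>) else 0) \<in> S" if "ip \<phi> \<phi> > 0" for \<phi>
  proof -
    have "\<bar>\<phi> i\<bar> \<le> sqrt (ip \<phi> \<phi>)" if "i \<in> I" for i
    proof -
      have "(\<phi> i)\<^sup>2 \<le> ip \<phi> \<phi>" unfolding ip_sq
        using fin that by (intro member_le_sum) auto
      then show ?thesis by (metis real_sqrt_abs real_sqrt_le_mono)
    qed
    then have "- 1 \<le> \<phi> i / sqrt (ip \<phi> \<phi>) \<and> \<phi> i / sqrt (ip \<phi> \<phi>) \<le> 1" if "i \<in> I" for i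
      using that \<open>ip \<phi> \<phi> > 0\<close> by (force simp: divide_simps abs_le_iff)
    moreover have "(\<Sum>i\<in>I. \<phi> i / sqrt (ip \<phi> \<phi>) * (\<phi> i / sqrt (ip \<phi> \<phi>)))
        = (\<Sum>i\<in>I. (\<phi> i)\<^sup>2 / ip \<phi> \<phi>)"
      using that by (intro sum.cong refl) (simp add: power2_eq_square)
    then have "(\<Sum>i\<in>I. \<phi> i / sqrt (ip \<phi> \<phi>) * (\<phi> i / sqrt (ip \<phi> \<phi>))) = 1"
      using that by (simp add: sum_divide_distrib[symmetric] ip_sq[symmetric])
    ultimately show ?thesis using that by (auto simp: S_def cube_def ip_def[of "\<lambda>i. if i \<in> I then _ i else _"])
  qed
  have pos: "ip \<psi> \<psi> > 0" using nz ip0[of \<psi>] sum_nonneg[of I "\<lambda>i. (\<psi> i)\<^sup>2"] unfolding ip_sq by force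
  then have "S \<noteq> {}" using normalize by blast
  then obtain \<psi>0 where \<psi>0: "\<psi>0 \<in> S"
    and min: "\<And>\<phi>. \<phi> \<in> S \<Longrightarrow> ip (B \<psi>0) (B \<psi>0) \<le> ip (B \<phi>) (B \<phi>)"
    using continuous_attains_inf[OF \<open>compact S\<close> _ continuous_on_subset[OF cont(2) subset_UNIV]] by blast
  define \<mu> where "\<mu> = ip (B \<psi>0) (B \<psi>0)"
  have "\<mu> \<ge> 0" unfolding \<mu>_def ip_sq by (rule sum_nonneg) simp
  have unit: "ip \<psi>0 \<psi>0 = 1" using \<psi>0 by (simp add: S_def)
  have ge: "\<mu> * ip \<phi> \<phi> \<le> ip (B \<phi>) (B \<phi>)" for \<phi>
  proof (cases "ip \<phi> \<phi> > 0")
    case True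
    have "B (\<lambda>i. if i \<in> I then \<phi> i / sqrt (ip \<phi> \<phi>) else 0) = (\<lambda>i. B \<phi> i / sqrt (ip \<phi> \<phi>))"
      unfolding B_def sum_divide_distrib by (intro ext sum.cong) auto
    then have "\<mu> \<le> ip (\<lambda>i. B \<phi> i / sqrt (ip \<phi> \<phi>)) (\<lambda>i. B \<phi> i / sqrt (ip \<phi> \<phi>))"
      using min[OF normalize[OF True]] by (simp add: \<mu>_def)
    also have "\<dots> = ip (B \<phi>) (B \<phi>) / ip \<phi> \<phi>"
      unfolding ip_def[of "\<lambda>i. B \<phi> i / _"] using True
      by (simp add: ip_def[of "B \<phi>"] sum_divide_distrib[symmetric])
    finally show ?thesis using True by (simp add: field_simps)
  next
    case False
    have "ip (B \<phi>) (B \<phi>) \<ge> 0" unfolding ip_sq by (rule sum_nonneg) simp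
    then show ?thesis
      using False \<open>\<mu> \<ge> 0\<close> by (smt (verit) mult_nonneg_nonpos)
  qed
  \<comment> \<open>First variation: a nonnegative quadratic polynomial in \<open>t\<close> without
    constant term has no linear term.\<close>
  have crit: "ip (B \<psi>0) (B \<phi>) - \<mu> * ip \<psi>0 \<phi> = 0" for \<phi>
  proof (rule linear_coefficient_zero)
    fix t
    have "\<mu> * (1 + 2 * ip \<psi>0 \<phi> * t + ip \<phi> \<phi> * t\<^sup>2)
        \<le> \<mu> + 2 * ip (B \<psi>0) (B \<phi>) * t + ip (B \<phi>) (B \<phi>) * t\<^sup>2"
      using ge[of "\<lambda>i. \<psi>0 i + t * \<phi> i"] unfolding B_lin ip_lin unit \<mu>_def .
    then show "0 \<le> (ip (B \<phi>) (B \<phi>) - \<mu> * ip \<phi> \<phi>) * t\<^sup>2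
        + 2 * (ip (B \<psi>0) (B \<phi>) - \<mu> * ip \<psi>0 \<phi>) * t"
      by (simp add: algebra_simps)
  qed
  define r where "r i = B (B \<psi>0) i - \<mu> * \<psi>0 i" for i
  have "ip r r = ip (B (B \<psi>0)) r - \<mu> * ip \<psi>0 r"
    unfolding ip_def r_def by (simp add: sum_subtractf[symmetric] sum_distrib_left algebra_simps)
  then have "ip r r = 0" using crit[of r] ip_B[of "B \<psi>0" r] by simp
  then have BB: "\<forall>i\<in>I. B (B \<psi>0) i = \<mu> * \<psi>0 i" unfolding ip0 by (simp add: r_def)
  define s where "s = sqrt \<mu>"
  have s: "s * s = \<mu>" "s \<ge> 0" using \<open>\<mu> \<ge> 0\<close> by (simp_all add: s_def)
  have "s \<ge> \<delta>"
  proof (rule ccontr)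
    assume "\<not> s \<ge> \<delta>"
    then have small: "\<bar>s\<bar> < \<delta>" "\<bar>- s\<bar> < \<delta>" using s by simp_all
    have "\<forall>i\<in>I. B (\<lambda>i. B \<psi>0 i + s * \<psi>0 i) i = s * (B \<psi>0 i + s * \<psi>0 i)"
      using BB unfolding B_lin s(1)[symmetric] by (simp add: algebra_simps)
    from eig[OF small(1) this] have "\<forall>i\<in>I. B \<psi>0 i = - s * \<psi>0 i" by (simp add: add_eq_0_iff2)
    from eig[OF small(2) this] show False using unit ip0[of \<psi>0] by simp
  qed
  then have "\<delta>\<^sup>2 \<le> \<mu>" using \<open>\<delta> \<ge> 0\<close> s(1) by (metis power2_eq_square power_mono)
  then have "\<delta>\<^sup>2 * ip \<psi> \<psi> \<le> \<mu> * ip \<psi> \<psi>" using pos by (intro mult_right_mono) auto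
  then show ?thesis using ge[of \<psi>] unfolding ip_sq by linarith
qed

section \<open>The lower bound on finitely supported sequences\<close>

text \<open>A vector fixed by \<open>P\<close> is fixed by its inverse, the adjugate, and the sum of
  the two matrices is \<open>trace P\<close> times the identity; hence
  \<open>trace P * w = 2 * w\<close>.\<close>

lemma unimodular_fixed_vector:
  fixes P :: "complex^2^2"
  assumes "det P = 1" "P *v w = w" "trace P \<noteq> 2"
  shows "w = 0"
proof -
  have w: "P$1$1 * w$1 + P$1$2 * w$2 = w$1" "P$2$1 * w$1 + P$2$2 * w$2 = w$2"
    using assms(2) by (simp_all add: vec_eq_iff forall_2 matrix_vector_mult_def sum_2)
  have "(P$1$1 * P$2$2 - P$1$2 * P$2$1) * w$1
      = P$2$2 * (P$1$1 * w$1 + P$1$2 * w$2) - P$1$2 * (P$2$1 * w$1 + P$2$2 * w$2)"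
    "(P$1$1 * P$2$2 - P$1$2 * P$2$1) * w$2
      = P$1$1 * (P$2$1 * w$1 + P$2$2 * w$2) - P$2$1 * (P$1$1 * w$1 + P$1$2 * w$2)"
    by (simp_all add: algebra_simps)
  then have e: "P$2$2 * w$1 - P$1$2 * w$2 = w$1" "P$1$1 * w$2 - P$2$1 * w$1 = w$2"
    unfolding w assms(1)[unfolded det_2] by simp_all
  have "(2 - trace P) * w$1
      = (w$1 - (P$1$1 * w$1 + P$1$2 * w$2)) + (w$1 - (P$2$2 * w$1 - P$1$2 * w$2))"
    "(2 - trace P) * w$2
      = (w$2 - (P$2$1 * w$1 + P$2$2 * w$2)) + (w$2 - (P$1$1 * w$2 - P$2$1 * w$1))"
    by (simp_all add: trace2 algebra_simps)
  then have "(2 - trace P) * w$1 = 0" "(2 - trace P) * w$2 = 0"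
    unfolding w e by simp_all
  then show ?thesis using assms(3) by (simp add: vec_eq_iff forall_2)
qed

lemma no_periodic_solution:
  fixes u :: "int \<Rightarrow> complex"
  assumes sol: "\<And>i. u (i + 1) = (E - of_real (if h (i + 1) = h i then 0 else V)) * u i - u (i - 1)"
    and per: "\<And>i. u (i + int q) = u i" and tr: "trace (run_prod (fib_letter V E h) 0 q) \<noteq> 2"
  shows "u (int k) = 0"
proof -
  have eq: "(vector [u (int k), u (int k - 1)] :: complex^2)
      = run_prod (fib_letter V E h) 0 k *v vector [u 0, u (- 1)]" for k
    using run_prod_solution[where m = 0, OF letter_one_step sol, of k] by simp
  have "(vector [u 0, u (- 1)] :: complex^2) = 0"
  proof (rule unimodular_fixed_vector[OF _ _ tr])
    show "det (run_prod (fib_letter V E h) 0 q) = 1" by (intro det_run_prod det_fib_letter)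
    have "u (int q) = u 0" "u (int q - 1) = u (- 1)"
      using per[of 0] per[of "- 1"] by (simp_all add: add.commute)
    then show "run_prod (fib_letter V E h) 0 q *v vector [u 0, u (- 1)] = vector [u 0, u (- 1)]"
      using eq[of q] by simp
  qed
  then have "(vector [u (int k), u (int k - 1)] :: complex^2) = 0" using eq[of k] by simp
  then show ?thesis by (simp add: vec_eq_iff forall_2)
qed

text \<open>An eigenvector of the operator on the cycle of length \<open>q\<close> unrolls to a
  periodic solution, which needs trace 2 over a period. So no eigenvalue lies within \<delta> of
  \<open>E\<close>.\<close>

lemma torus_lower_bound:
  fixes E V \<delta> :: real and \<psi> :: "int \<Rightarrow> real"
  assumes "q > 0" and per: "\<And>n. h (n + int q) = h n + p"
    and tr: "\<And>E'. \<bar>E' - E\<bar> < \<delta> \<Longrightarrow>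
      trace (run_prod (fib_letter V (complex_of_real E') h) 0 q) \<noteq> 2"
    and "\<delta> \<ge> 0"
  defines "v \<equiv> \<lambda>n. if h (n + 1) = h n then 0 else V"
  shows "\<delta>\<^sup>2 * (\<Sum>i\<in>{0..<int q}. (\<psi> i)\<^sup>2) \<le> (\<Sum>i\<in>{0..<int q}.
    (\<psi> ((i + 1) mod int q) + \<psi> ((i - 1) mod int q) + (v i - E) * \<psi> i)\<^sup>2)"
proof -
  let ?I = "{0..<int q}"
  \<comment> \<open>The indicators are added up, so that neighbours that coincide for
    \<open>q \<le> 2\<close> are counted with multiplicity.\<close>
  define b :: "int \<Rightarrow> int \<Rightarrow> real" where "b i j = of_bool (j = (i + 1) mod int q)
    + of_bool (j = (i - 1) mod int q) + (v i - E) * of_bool (j = i)" for i j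
  have B: "(\<Sum>j\<in>?I. b i j * \<phi> j)
      = \<phi> ((i + 1) mod int q) + \<phi> ((i - 1) mod int q) + (v i - E) * \<phi> i" if "i \<in> ?I" for i \<phi>
  proof -
    have m: "k mod int q \<in> ?I" for k using \<open>q > 0\<close> by simp
    have "(\<Sum>j\<in>?I. of_bool (j = k) * \<phi> j) = \<phi> k" if "k \<in> ?I" for k
      using that sum.delta[of ?I k \<phi>] by (simp add: of_bool_def if_distrib[of "\<lambda>x. x * _"] cong: if_cong)
    from this[OF m, of "i + 1"] this[OF m, of "i - 1"] this[OF that]
    show ?thesis by (simp add: b_def distrib_right sum.distrib mult.assoc flip: sum_distrib_left)
  qed
  have shift: "j = (i + 1) mod int q \<longleftrightarrow> i = (j - 1) mod int q" if "i \<in> ?I" "j \<in> ?I" for i j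
  proof -
    have "i = (j - 1) mod int q" if "j = (i + 1) mod int q"
      unfolding that mod_diff_left_eq using \<open>i \<in> ?I\<close> by simp
    moreover have "j = (i + 1) mod int q" if "i = (j - 1) mod int q"
      unfolding that mod_add_left_eq using \<open>j \<in> ?I\<close> by simp
    ultimately show ?thesis by blast
  qed
  have sym: "b i j = b j i" if "i \<in> ?I" "j \<in> ?I" for i j
    using shift[OF that] shift[OF that(2,1)] by (auto simp: b_def)
  have vper: "v (n + int q) = v n" for n
  proof -
    have "n + int q + 1 = n + 1 + int q" by simp
    then show ?thesis unfolding v_def by (simp only: per add_right_cancel)
  qed
  have vmod: "v (n mod int q) = v n" for n
  proof -
    have "v (n + int q * int k) = v n" for n k
    proof (induction k)
      case (Suc k)
      have "n + int q * int (Suc k) = n + int q * int k + int q" by (simp add: algebra_simps)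
      then show ?case by (simp only: vper Suc)
    qed simp
    note add_mult = this
    show ?thesis
    proof (cases "n div int q" rule: int_cases2)
      case (nonneg k)
      then have "n = n mod int q + int q * int k" by (metis mod_mult_div_eq)
      then show ?thesis by (metis add_mult)
    next
      case (nonpos k)
      then have "n mod int q = n + int q * int k"
        using mod_mult_div_eq[of n "int q"] by simp
      then show ?thesis by (metis add_mult)
    qed
  qed
  have "\<delta>\<^sup>2 * (\<Sum>i\<in>?I. (\<psi> i)\<^sup>2) \<le> (\<Sum>i\<in>?I. (\<Sum>j\<in>?I. b i j * \<psi> j)\<^sup>2)"
  proof (rule symmetric_lower_bound)
    fix s \<phi> assume s: "\<bar>s\<bar> < \<delta>" and eig: "\<forall>i\<in>?I. (\<Sum>j\<in>?I. b i j * \<phi> j) = s * \<phi> i"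
    define u where "u n = complex_of_real (\<phi> (n mod int q))" for n
    have "u (i + 1) = (of_real (E + s) - of_real (if h (i + 1) = h i then 0 else V)) * u i - u (i - 1)" for i
    proof -
      have "i mod int q \<in> ?I" using \<open>q > 0\<close> by simp
      from eig[rule_format, OF this]
      have "\<phi> ((i + 1) mod int q) + \<phi> ((i - 1) mod int q) + (v i - E) * \<phi> (i mod int q)
          = s * \<phi> (i mod int q)"
        unfolding B[OF \<open>i mod int q \<in> ?I\<close>] by (simp add: mod_add_left_eq mod_diff_left_eq vmod)
      then have "\<phi> ((i + 1) mod int q) = (E + s - v i) * \<phi> (i mod int q) - \<phi> ((i - 1) mod int q)"
        by (simp add: algebra_simps)
      then show ?thesis unfolding u_def v_def
        by (simp only: of_real_diff[symmetric] of_real_mult[symmetric])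
    qed
    moreover have "u (i + int q) = u i" for i by (simp add: u_def)
    moreover have "trace (run_prod (fib_letter V (complex_of_real (E + s)) h) 0 q) \<noteq> 2"
      using tr[of "E + s"] s by simp
    ultimately have "u (int k) = 0" for k by (rule no_periodic_solution)
    then show "\<forall>i\<in>?I. \<phi> i = 0"
      by (metis atLeastLessThan_iff mod_pos_pos_trivial nonneg_int_cases of_real_eq_0_iff u_def)
  qed (use sym \<open>\<delta> \<ge> 0\<close> in auto)
  then show ?thesis using B by simp
qed

text \<open>\<open>\<psi>\<close> vanishes around the seam of the cycle, so the periodic operator
  acts on it as the operator on the line. The constant depends on the escape radius only, not on
  \<open>M\<close> or \<omega>.\<close>

lemma window_lower_bound:
  fixes E V \<delta> :: real and \<psi> :: "int \<Rightarrow> real"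
  assumes esc: "\<And>E' j. \<bar>E' - E\<bar> < \<delta> \<Longrightarrow> j \<ge> k0 \<Longrightarrow> cmod (fibtr V (complex_of_real E') j) > 2"
    and "\<delta> \<ge> 0" and supp: "\<And>n. \<psi> n \<noteq> 0 \<Longrightarrow> 1 \<le> n \<and> n \<le> int M"
  shows "\<delta>\<^sup>2 * (\<Sum>n\<in>{0..int M + 1}. (\<psi> n)\<^sup>2) \<le> (\<Sum>n\<in>{0..int M + 1}.
    (\<psi> (n + 1) + \<psi> (n - 1) + (fib_potential V \<omega> n - E) * \<psi> n)\<^sup>2)"
proof -
  \<comment> \<open>The image of \<open>\<psi>\<close> lives on \<open>0..M + 1\<close>. The value
    \<open>M + 3\<close> keeps the right neighbours of these sites below \<open>q\<close> and covers
    the heights that determine the potential there.\<close>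
  obtain j h where jh: "j \<ge> k0" "fib (j + 2) \<ge> M + 3"
    "balanced (real (fib (j + 1)) / real (fib (j + 2))) h"
    "\<And>n. h (n + int (fib (j + 2))) = h n + int (fib (j + 1))"
    and agree: "\<And>n. 0 \<le> n \<Longrightarrow> n \<le> int (M + 3) \<Longrightarrow> h n = fib_height \<omega> n"
    using periodic_approximant[of k0 "M + 3"] by blast
  define q where "q = fib (j + 2)"
  have q: "int q \<ge> int M + 3" using jh(2) by (simp add: q_def)
  define v where "v n = (if h (n + 1) = h n then 0 else V)" for n
  let ?f = "\<lambda>i. \<psi> ((i + 1) mod int q) + \<psi> ((i - 1) mod int q) + (v i - E) * \<psi> i"
  have "trace (run_prod (fib_letter V (complex_of_real E') h) 0 q) \<noteq> 2" if "\<bar>E' - E\<bar> < \<delta>" for E'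
  proof -
    have "trace (run_prod (fib_letter V (complex_of_real E') h) 0 q) = fibtr V (complex_of_real E') (j + 2)"
      using trace_periodic_word[OF jh(3,4), of V _ 0 0] unfolding add_0 fib_letter_def q_def .
    moreover have "cmod (fibtr V (complex_of_real E') (j + 2)) > 2"
      using esc[OF that] jh(1) by (meson le_add1 order_trans)
    ultimately show ?thesis by (metis less_irrefl norm_numeral)
  qed
  then have "\<delta>\<^sup>2 * (\<Sum>i\<in>{0..<int q}. (\<psi> i)\<^sup>2) \<le> (\<Sum>i\<in>{0..<int q}. (?f i)\<^sup>2)"
    unfolding v_def using q \<open>\<delta> \<ge> 0\<close>
    by (intro torus_lower_bound[where p = "int (fib (j + 1))"])
      (use jh(4) in \<open>simp_all add: q_def del: fib.simps\<close>)
  moreover have "(\<Sum>i\<in>{0..<int q}. (\<psi> i)\<^sup>2) = (\<Sum>i\<in>{0..int M + 1}. (\<psi> i)\<^sup>2)"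
    using supp q by (intro sum.mono_neutral_right) (auto, force)
  moreover have "(\<Sum>i\<in>{0..<int q}. (?f i)\<^sup>2) = (\<Sum>i\<in>{0..int M + 1}. (?f i)\<^sup>2)"
  proof (intro sum.mono_neutral_right ballI)
    fix i assume "i \<in> {0..<int q} - {0..int M + 1}"
    then have i: "int M + 2 \<le> i" "i < int q" by auto
    have "(i + 1) mod int q = (if i + 1 = int q then 0 else i + 1)" "(i - 1) mod int q = i - 1"
      using i by auto
    moreover have "\<psi> 0 = 0" "\<psi> (i + 1) = 0" "\<psi> (i - 1) = 0" "\<psi> i = 0"
      using supp[of 0] supp[of "i + 1"] supp[of "i - 1"] supp[of i] i by auto
    ultimately show "(?f i)\<^sup>2 = 0" by simp
  qed (use q in auto)
  moreover have "?f i = \<psi> (i + 1) + \<psi> (i - 1) + (fib_potential V \<omega> i - E) * \<psi> i"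
    if "i \<in> {0..int M + 1}" for i
  proof -
    have "v i = fib_potential V \<omega> i"
      using agree[of i] agree[of "i + 1"] that by (simp add: v_def fib_potential_height)
    moreover have "(i + 1) mod int q = i + 1" using that q by simp
    moreover have "\<psi> ((i - 1) mod int q) = \<psi> (i - 1)"
    proof (cases "i = 0")
      case True
      have "(- 1) mod int q = int q - 1" using zmod_minus1[of "int q"] q by simp
      then show ?thesis using supp[of "int q - 1"] supp[of "- 1"] q True by force
    qed (use that q in simp)
    ultimately show ?thesis by simp
  qed
  ultimately show ?thesis by simp
qed

section \<open>Square-summable sequences\<close>

definition ell2_inner :: "(int \<Rightarrow> complex) \<Rightarrow> (int \<Rightarrow> complex) \<Rightarrow> complex" where
  "ell2_inner \<phi> \<theta> = (\<Sum>\<^sub>\<infinity>n. \<phi> n * cnj (\<theta> n))"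

definition ell2_sq :: "(int \<Rightarrow> complex) \<Rightarrow> real" where
  "ell2_sq \<phi> = (\<Sum>\<^sub>\<infinity>n. (cmod (\<phi> n))\<^sup>2)"

lemma ell2_norm_sq: "ell2_norm \<phi> = sqrt (ell2_sq \<phi>)"
  by (simp add: ell2_norm_def ell2_sq_def)

lemma ell2_summable: "\<phi> \<in> ell2 \<Longrightarrow> (\<lambda>n. (cmod (\<phi> n))\<^sup>2) summable_on UNIV"
  by (simp add: ell2_def)

lemma ell2I_bound:
  assumes "\<And>F. finite F \<Longrightarrow> (\<Sum>n\<in>F. (cmod (\<phi> n))\<^sup>2) \<le> C"
  shows "\<phi> \<in> ell2" "ell2_sq \<phi> \<le> C"
proof -
  have s: "(\<lambda>n. (cmod (\<phi> n))\<^sup>2) summable_on UNIV"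
    by (rule nonneg_bdd_above_summable_on) (use assms in \<open>auto intro!: bdd_aboveI\<close>)
  then show "\<phi> \<in> ell2" by (simp add: ell2_def)
  show "ell2_sq \<phi> \<le> C" unfolding ell2_sq_def by (rule infsum_le_finite_sums[OF s]) (use assms in auto)
qed

lemma ell2_sq_nonneg: "0 \<le> ell2_sq \<phi>"
  unfolding ell2_sq_def by (rule infsum_nonneg) simp

lemma sum_le_ell2_sq:
  "\<phi> \<in> ell2 \<Longrightarrow> finite F \<Longrightarrow> (\<Sum>n\<in>F. (cmod (\<phi> n))\<^sup>2) \<le> ell2_sq \<phi>"
  unfolding ell2_sq_def by (rule finite_sum_le_infsum) (auto simp: ell2_summable)

lemma cmod_le_ell2_sq: "\<phi> \<in> ell2 \<Longrightarrow> (cmod (\<phi> n))\<^sup>2 \<le> ell2_sq \<phi>"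
  using sum_le_ell2_sq[of \<phi> "{n}"] by simp

lemma ell2_sq_eq_0:
  assumes "\<phi> \<in> ell2" "ell2_sq \<phi> \<le> 0"
  shows "\<phi> n = 0"
proof -
  have "(cmod (\<phi> n))\<^sup>2 \<le> 0" using cmod_le_ell2_sq[OF assms(1), of n] assms(2) by linarith
  then show ?thesis by simp
qed

lemma ell2_scale: "\<phi> \<in> ell2 \<Longrightarrow> (\<lambda>n. c * \<phi> n) \<in> ell2"
  unfolding ell2_def by (simp add: norm_mult power_mult_distrib summable_on_cmult_right)

lemma ell2_add:
  assumes "\<phi> \<in> ell2" "\<theta> \<in> ell2"
  shows "(\<lambda>n. \<phi> n + \<theta> n) \<in> ell2"
proof (rule ell2I_bound(1))
  fix F :: "int set" assume "finite F"
  have "(cmod (a + b))\<^sup>2 \<le> 2 * (cmod a)\<^sup>2 + 2 * (cmod b)\<^sup>2" for a b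
  proof -
    have "(cmod (a + b))\<^sup>2 \<le> (cmod a + cmod b)\<^sup>2" by (intro power_mono norm_triangle_ineq) simp
    also have "\<dots> \<le> 2 * (cmod a)\<^sup>2 + 2 * (cmod b)\<^sup>2"
      using sum_squares_bound[of "cmod a" "cmod b"] by (simp add: power2_sum)
    finally show ?thesis .
  qed
  then have "(\<Sum>n\<in>F. (cmod (\<phi> n + \<theta> n))\<^sup>2) \<le> (\<Sum>n\<in>F. 2 * (cmod (\<phi> n))\<^sup>2 + 2 * (cmod (\<theta> n))\<^sup>2)"
    by (intro sum_mono)
  also have "\<dots> \<le> 2 * ell2_sq \<phi> + 2 * ell2_sq \<theta>"
    unfolding sum.distrib sum_distrib_left[symmetric]
    using assms \<open>finite F\<close> by (intro add_mono mult_left_mono sum_le_ell2_sq) auto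
  finally show "(\<Sum>n\<in>F. (cmod (\<phi> n + \<theta> n))\<^sup>2) \<le> 2 * ell2_sq \<phi> + 2 * ell2_sq \<theta>" .
qed

lemma ell2_add_scale: "\<phi> \<in> ell2 \<Longrightarrow> \<theta> \<in> ell2 \<Longrightarrow> (\<lambda>n. \<phi> n + c * \<theta> n) \<in> ell2"
  by (intro ell2_add ell2_scale)

lemma bij_int_add: "bij (\<lambda>n :: int. n + k)"
  by (rule bij_betw_byWitness[where f' = "\<lambda>n. n - k"]) auto

lemma ell2_shift: "\<phi> \<in> ell2 \<Longrightarrow> (\<lambda>n. \<phi> (n + k)) \<in> ell2"
  unfolding ell2_def
  using summable_on_reindex_bij_betw[OF bij_int_add, of "\<lambda>n. (cmod (\<phi> n))\<^sup>2" k] by simp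

lemma ell2_mult_bounded:
  assumes "\<phi> \<in> ell2" and w: "\<And>n. cmod (w n) \<le> C"
  shows "(\<lambda>n. w n * \<phi> n) \<in> ell2"
proof (rule ell2I_bound(1))
  fix F :: "int set" assume "finite F"
  have "C \<ge> 0" using w[of 0] norm_ge_zero order_trans by blast
  have "(\<Sum>n\<in>F. (cmod (w n * \<phi> n))\<^sup>2) \<le> (\<Sum>n\<in>F. C\<^sup>2 * (cmod (\<phi> n))\<^sup>2)"
    unfolding norm_mult power_mult_distrib using w by (intro sum_mono mult_right_mono power_mono) auto
  also have "\<dots> \<le> C\<^sup>2 * ell2_sq \<phi>"
    unfolding sum_distrib_left[symmetric] using assms \<open>finite F\<close> by (intro mult_left_mono sum_le_ell2_sq) auto
  finally show "(\<Sum>n\<in>F. (cmod (w n * \<phi> n))\<^sup>2) \<le> C\<^sup>2 * ell2_sq \<phi>" .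
qed

lemma ell2_inner_summable:
  assumes "\<phi> \<in> ell2" "\<theta> \<in> ell2"
  shows "(\<lambda>n. \<phi> n * cnj (\<theta> n)) summable_on UNIV"
proof (rule Infinite_Sum.abs_summable_summable, rule Infinite_Sum.abs_summable_on_comparison_test')
  show "(\<lambda>n. (cmod (\<phi> n))\<^sup>2 + (cmod (\<theta> n))\<^sup>2) summable_on UNIV"
    by (intro summable_on_add ell2_summable assms)
  show "norm (\<phi> n * cnj (\<theta> n)) \<le> (cmod (\<phi> n))\<^sup>2 + (cmod (\<theta> n))\<^sup>2" for n
  proof -
    have "2 * (cmod (\<phi> n) * cmod (\<theta> n)) \<le> (cmod (\<phi> n))\<^sup>2 + (cmod (\<theta> n))\<^sup>2"
      using sum_squares_bound[of "cmod (\<phi> n)" "cmod (\<theta> n)"] by (simp add: mult.assoc)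
    moreover have "0 \<le> cmod (\<phi> n) * cmod (\<theta> n)" by simp
    ultimately show ?thesis unfolding norm_mult complex_mod_cnj by linarith
  qed
qed

lemma ell2_inner_self:
  assumes "\<phi> \<in> ell2"
  shows "ell2_inner \<phi> \<phi> = of_real (ell2_sq \<phi>)"
proof -
  have "((\<lambda>n. complex_of_real ((cmod (\<phi> n))\<^sup>2)) has_sum of_real (ell2_sq \<phi>)) UNIV"
    unfolding ell2_sq_def by (intro has_sum_of_real has_sum_infsum ell2_summable assms)
  then show ?thesis
    unfolding ell2_inner_def complex_norm_square by (rule infsumI)
qed

lemma ell2_inner_commute: "ell2_inner \<theta> \<phi> = cnj (ell2_inner \<phi> \<theta>)"
  unfolding ell2_inner_def by (simp add: infsum_cnj[symmetric] mult.commute del: infsum_cnj)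

lemma ell2_inner_add_left:
  assumes "\<phi> \<in> ell2" "\<theta> \<in> ell2" "\<eta> \<in> ell2"
  shows "ell2_inner (\<lambda>n. \<phi> n + c * \<theta> n) \<eta> = ell2_inner \<phi> \<eta> + c * ell2_inner \<theta> \<eta>"
proof -
  have "ell2_inner (\<lambda>n. \<phi> n + c * \<theta> n) \<eta>
      = (\<Sum>\<^sub>\<infinity>n. \<phi> n * cnj (\<eta> n) + c * (\<theta> n * cnj (\<eta> n)))"
    by (simp add: ell2_inner_def algebra_simps)
  also have "\<dots> = ell2_inner \<phi> \<eta> + c * ell2_inner \<theta> \<eta>"
    unfolding ell2_inner_def
    by (subst infsum_add) (use assms in \<open>simp_all add: ell2_inner_summable summable_on_cmult_right infsum_cmult_right'\<close>)
  finally show ?thesis .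
qed

lemma ell2_inner_add_right:
  assumes "\<phi> \<in> ell2" "\<theta> \<in> ell2" "\<eta> \<in> ell2"
  shows "ell2_inner \<eta> (\<lambda>n. \<phi> n + c * \<theta> n) = ell2_inner \<eta> \<phi> + cnj c * ell2_inner \<eta> \<theta>"
proof -
  have "ell2_inner \<eta> (\<lambda>n. \<phi> n + c * \<theta> n) = cnj (ell2_inner (\<lambda>n. \<phi> n + c * \<theta> n) \<eta>)"
    by (rule ell2_inner_commute)
  also have "\<dots> = cnj (ell2_inner \<phi> \<eta>) + cnj c * cnj (ell2_inner \<theta> \<eta>)"
    unfolding ell2_inner_add_left[OF assms] by simp
  finally show ?thesis unfolding ell2_inner_commute[symmetric] .
qed

lemma ell2_sq_add_scale:
  assumes "\<phi> \<in> ell2" "\<theta> \<in> ell2"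
  shows "complex_of_real (ell2_sq (\<lambda>n. \<phi> n + c * \<theta> n)) = of_real (ell2_sq \<phi>)
    + c * ell2_inner \<theta> \<phi> + cnj c * ell2_inner \<phi> \<theta> + c * cnj c * of_real (ell2_sq \<theta>)"
  using assms
  by (simp add: ell2_inner_self[symmetric] ell2_inner_add_left ell2_inner_add_right ell2_add_scale algebra_simps)

lemma ell2_inner_shift: "ell2_inner (\<lambda>n. \<phi> (n + k)) \<theta> = ell2_inner \<phi> (\<lambda>n. \<theta> (n - k))"
  unfolding ell2_inner_def
  using infsum_reindex_bij_betw[OF bij_int_add, of "\<lambda>n. \<phi> n * cnj (\<theta> (n - k))" k] by simp

section \<open>Jacobi operators and their resolvents\<close>

definition jacobi :: "(int \<Rightarrow> real) \<Rightarrow> complex \<Rightarrow> (int \<Rightarrow> complex) \<Rightarrow> int \<Rightarrow> complex" where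
  "jacobi v z \<psi> n = \<psi> (n + 1) + \<psi> (n - 1) + (of_real (v n) - z) * \<psi> n"

locale bounded_jacobi =
  fixes v :: "int \<Rightarrow> real" and W :: real
  assumes v_bound: "\<And>n. \<bar>v n\<bar> \<le> W"
begin

lemma coeff_bound: "cmod (of_real (v n) - z) \<le> W + cmod z"
  using norm_triangle_ineq4[of "complex_of_real (v n)" z] v_bound[of n] by simp

lemma jacobi_ell2: "\<psi> \<in> ell2 \<Longrightarrow> jacobi v z \<psi> \<in> ell2"
  unfolding jacobi_def[abs_def] diff_conv_add_uminus[of _ 1]
  by (intro ell2_add ell2_shift ell2_mult_bounded[where C = "W + cmod z"] coeff_bound)

lemma jacobi_add_scale:
  "jacobi v z (\<lambda>n. \<phi> n + c * \<theta> n) = (\<lambda>n. jacobi v z \<phi> n + c * jacobi v z \<theta> n)"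
  by (rule ext) (simp add: jacobi_def algebra_simps)

lemma jacobi_adjoint:
  assumes "\<phi> \<in> ell2" "\<theta> \<in> ell2"
  shows "ell2_inner (jacobi v z \<phi>) \<theta> = ell2_inner \<phi> (jacobi v (cnj z) \<theta>)"
proof -
  have mem: "(\<lambda>n. \<eta> (n + 1)) \<in> ell2" "(\<lambda>n. \<eta> (n - 1)) \<in> ell2"
    "(\<lambda>n. (of_real (v n) - w) * \<eta> n) \<in> ell2" if "\<eta> \<in> ell2" for \<eta> w
  proof -
    show "(\<lambda>n. \<eta> (n + 1)) \<in> ell2" by (rule ell2_shift[OF that])
    show "(\<lambda>n. \<eta> (n - 1)) \<in> ell2" using ell2_shift[OF that, of "- 1"] by simp
    show "(\<lambda>n. (of_real (v n) - w) * \<eta> n) \<in> ell2"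
      by (rule ell2_mult_bounded[OF that coeff_bound])
  qed
  note \<phi> = mem[OF assms(1)] and \<theta> = mem[OF assms(2)]
  have "ell2_inner (jacobi v z \<phi>) \<theta> = ell2_inner (\<lambda>n. \<phi> (n + 1)) \<theta>
      + ell2_inner (\<lambda>n. \<phi> (n - 1)) \<theta> + ell2_inner (\<lambda>n. (of_real (v n) - z) * \<phi> n) \<theta>"
    using ell2_inner_add_left[OF ell2_add[OF \<phi>(1,2)] \<phi>(3) assms(2), of 1 z]
      ell2_inner_add_left[OF \<phi>(1,2) assms(2), of 1]
    by (simp add: jacobi_def[abs_def])
  also have "ell2_inner (\<lambda>n. \<phi> (n + 1)) \<theta> = ell2_inner \<phi> (\<lambda>n. \<theta> (n - 1))"
    by (rule ell2_inner_shift)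
  also have "ell2_inner (\<lambda>n. \<phi> (n - 1)) \<theta> = ell2_inner \<phi> (\<lambda>n. \<theta> (n + 1))"
    using ell2_inner_shift[of \<phi> "- 1" \<theta>] by simp
  also have "ell2_inner (\<lambda>n. (of_real (v n) - z) * \<phi> n) \<theta>
      = ell2_inner \<phi> (\<lambda>n. (of_real (v n) - cnj z) * \<theta> n)"
    by (simp add: ell2_inner_def mult_ac)
  also have "ell2_inner \<phi> (\<lambda>n. \<theta> (n - 1)) + ell2_inner \<phi> (\<lambda>n. \<theta> (n + 1))
      + ell2_inner \<phi> (\<lambda>n. (of_real (v n) - cnj z) * \<theta> n) = ell2_inner \<phi> (jacobi v (cnj z) \<theta>)"
    using ell2_inner_add_right[OF ell2_add[OF \<theta>(1,2)] \<theta>(3) assms(1), of 1 "cnj z"]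
      ell2_inner_add_right[OF \<theta>(1,2) assms(1), of 1]
    by (simp add: jacobi_def[abs_def] add.commute)
  finally show ?thesis .
qed

text \<open>The cross terms cancel because the real part of the operator is symmetric and the rest
  is an imaginary multiple of the identity. Two uses: a lower bound at nonreal \<open>z\<close>, and
  equal norms at \<open>z\<close> and \<open>cnj z\<close>.\<close>

lemma jacobi_sq_split:
  assumes "\<phi> \<in> ell2"
  shows "ell2_sq (jacobi v z \<phi>) = ell2_sq (jacobi v (of_real (Re z)) \<phi>) + (Im z)\<^sup>2 * ell2_sq \<phi>"
proof -
  let ?J = "jacobi v (of_real (Re z)) \<phi>"
  define c where "c = - (\<i> * of_real (Im z))"
  have z: "z = of_real (Re z) - c" unfolding c_def using complex_eq[of z] by simp
  have "jacobi v z \<phi> = (\<lambda>n. ?J n + c * \<phi> n)"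
    by (subst z, rule ext) (simp add: jacobi_def algebra_simps)
  then have "complex_of_real (ell2_sq (jacobi v z \<phi>)) = of_real (ell2_sq ?J)
      + c * ell2_inner \<phi> ?J + cnj c * ell2_inner ?J \<phi> + c * cnj c * of_real (ell2_sq \<phi>)"
    using ell2_sq_add_scale[OF jacobi_ell2 assms] assms by simp
  also have "ell2_inner ?J \<phi> = ell2_inner \<phi> ?J"
    using jacobi_adjoint[OF assms assms, of "of_real (Re z)"] by simp
  also have "cnj c = - c" by (simp add: c_def)
  also have "c * - c = of_real ((Im z)\<^sup>2)" by (simp add: c_def power2_eq_square complex_eq_iff)
  finally have "complex_of_real (ell2_sq (jacobi v z \<phi>))
      = of_real (ell2_sq ?J + (Im z)\<^sup>2 * ell2_sq \<phi>)" by simp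
  then show ?thesis unfolding of_real_eq_iff .
qed

lemma jacobi_sq_upper:
  obtains K where "K > 0" "\<And>\<phi>. \<phi> \<in> ell2 \<Longrightarrow> ell2_sq (jacobi v z \<phi>) \<le> K * ell2_sq \<phi>"
proof
  define C where "C = W + cmod z"
  define K where "K = 3 * (2 + C\<^sup>2)"
  show "K > 0" by (simp add: K_def add_pos_nonneg)
  fix \<phi> assume \<phi>: "\<phi> \<in> ell2"
  have C: "0 \<le> C" using coeff_bound[of 0 z] norm_ge_zero order_trans unfolding C_def by blast
  have tri: "(cmod (a + b + d * e))\<^sup>2 \<le> 3 * ((cmod a)\<^sup>2 + (cmod b)\<^sup>2 + C\<^sup>2 * (cmod e)\<^sup>2)"
    if "cmod d \<le> C" for a b d e
  proof -
    have "cmod (d * e) \<le> C * cmod e" using that by (simp add: norm_mult mult_right_mono)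
    then have "cmod (a + b + d * e) \<le> cmod a + cmod b + C * cmod e"
      using norm_triangle_ineq[of "a + b" "d * e"] norm_triangle_ineq[of a b] by linarith
    then have "(cmod (a + b + d * e))\<^sup>2 \<le> (cmod a + cmod b + C * cmod e)\<^sup>2"
      by (intro power_mono) auto
    also have "\<dots> \<le> 3 * ((cmod a)\<^sup>2 + (cmod b)\<^sup>2 + (C * cmod e)\<^sup>2)"
      using sum_squares_bound[of "cmod a" "cmod b"] sum_squares_bound[of "cmod a" "C * cmod e"]
        sum_squares_bound[of "cmod b" "C * cmod e"]
      by (simp add: power2_eq_square algebra_simps)
    finally show ?thesis by (simp add: power_mult_distrib)
  qed
  have "(\<Sum>n\<in>F. (cmod (jacobi v z \<phi> n))\<^sup>2) \<le> K * ell2_sq \<phi>" if F: "finite F" for F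
  proof -
    have shift: "(\<Sum>n\<in>F. (cmod (\<phi> (n + k)))\<^sup>2) \<le> ell2_sq \<phi>" for k
      using sum.reindex[of "\<lambda>n. n + k" F "\<lambda>n. (cmod (\<phi> n))\<^sup>2"] sum_le_ell2_sq[OF \<phi>, of "(\<lambda>n. n + k) ` F"] F
      by (simp add: o_def)
    have "(\<Sum>n\<in>F. (cmod (jacobi v z \<phi> n))\<^sup>2)
        \<le> (\<Sum>n\<in>F. 3 * ((cmod (\<phi> (n + 1)))\<^sup>2 + (cmod (\<phi> (n - 1)))\<^sup>2 + C\<^sup>2 * (cmod (\<phi> n))\<^sup>2))"
      unfolding jacobi_def by (intro sum_mono tri) (simp add: C_def coeff_bound)
    also have "\<dots> \<le> 3 * (ell2_sq \<phi> + ell2_sq \<phi> + C\<^sup>2 * ell2_sq \<phi>)"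
      unfolding sum_distrib_left[symmetric] sum.distrib
      using shift[of 1] shift[of "- 1"] shift[of 0] by (intro mult_left_mono add_mono) auto
    finally show ?thesis by (simp add: K_def algebra_simps)
  qed
  from ell2I_bound(2)[OF this] show "ell2_sq (jacobi v z \<phi>) \<le> K * ell2_sq \<phi>" .
qed

text \<open>
  With \<open>S = 1 - \<tau> J J\<^sup>*\<close> a strict contraction for small \<open>\<tau>\<close>, the Neumann series
  \<open>\<tau> (\<Sum>k. S\<^sup>k f)\<close> inverts \<open>J J\<^sup>*\<close>.
\<close>

lemma jacobi_surj:
  assumes "c > 0" and lower: "\<And>\<phi>. \<phi> \<in> ell2 \<Longrightarrow> c * ell2_sq \<phi> \<le> ell2_sq (jacobi v (cnj z) \<phi>)"
    and f: "f \<in> ell2"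
  shows "\<exists>\<psi>\<in>ell2. jacobi v z \<psi> = f"
proof -
  let ?J = "jacobi v z" and ?J' = "jacobi v (cnj z)"
  obtain K0 where K0: "K0 > 0" "\<And>\<phi>. \<phi> \<in> ell2 \<Longrightarrow> ell2_sq (?J \<phi>) \<le> K0 * ell2_sq \<phi>"
    using jacobi_sq_upper by blast
  \<comment> \<open>The summand \<open>c\<close> ensures \<open>\<tau> * c \<le> 1\<close>, so that
    the contraction factor \<open>r\<close> is nonnegative.\<close>
  define K where "K = K0 + c"
  define \<tau> where "\<tau> = 1 / K"
  have \<tau>: "\<tau> > 0" "\<tau> * K = 1" "\<tau> * c \<le> 1" "K > 0"
    using K0(1) \<open>c > 0\<close> by (auto simp: \<tau>_def K_def)
  define r where "r = 1 - \<tau> * c"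
  have r: "0 \<le> r" "r < 1" using \<tau> \<open>c > 0\<close> by (simp_all add: r_def)
  define S where "S \<phi> = (\<lambda>n. \<phi> n + (- of_real \<tau>) * ?J (?J' \<phi>) n)" for \<phi>
  have S_ell2: "S \<phi> \<in> ell2" if "\<phi> \<in> ell2" for \<phi>
    unfolding S_def by (intro ell2_add_scale jacobi_ell2 that)
  have S_sq: "ell2_sq (S \<phi>) \<le> r * ell2_sq \<phi>" if \<phi>: "\<phi> \<in> ell2" for \<phi>
  proof -
    let ?t = "?J' \<phi>"
    have t: "?t \<in> ell2" "?J ?t \<in> ell2" using \<phi> by (auto intro: jacobi_ell2)
    have "ell2_inner (?J ?t) \<phi> = of_real (ell2_sq ?t)"
      using jacobi_adjoint[OF t(1) \<phi>] t(1) by (simp add: ell2_inner_self)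
    moreover from this have "ell2_inner \<phi> (?J ?t) = of_real (ell2_sq ?t)"
      using ell2_inner_commute[of \<phi> "?J ?t"] by simp
    ultimately have "complex_of_real (ell2_sq (S \<phi>))
        = of_real (ell2_sq \<phi> - 2 * \<tau> * ell2_sq ?t + \<tau> * \<tau> * ell2_sq (?J ?t))"
      unfolding S_def ell2_sq_add_scale[OF \<phi> t(2)] by simp
    then have "ell2_sq (S \<phi>) = ell2_sq \<phi> - 2 * \<tau> * ell2_sq ?t + \<tau> * \<tau> * ell2_sq (?J ?t)"
      unfolding of_real_eq_iff .
    \<comment> \<open>Since \<open>\<tau> * K = 1\<close>, the quadratic term uses up at most half
      of the linear one.\<close>
    also have "\<dots> \<le> ell2_sq \<phi> - 2 * \<tau> * ell2_sq ?t + \<tau> * \<tau> * (K * ell2_sq ?t)"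
      using K0(2)[OF t(1)] \<open>c > 0\<close> ell2_sq_nonneg[of ?t] \<tau>(1)
      by (intro add_left_mono mult_left_mono) (auto simp: K_def distrib_right intro: add_increasing2)
    also have "\<tau> * \<tau> * (K * ell2_sq ?t) = (\<tau> * K) * (\<tau> * ell2_sq ?t)" by simp
    also have "ell2_sq \<phi> - 2 * \<tau> * ell2_sq ?t + (\<tau> * K) * (\<tau> * ell2_sq ?t)
        = ell2_sq \<phi> - \<tau> * ell2_sq ?t" unfolding \<tau>(2) by simp
    also have "\<dots> \<le> ell2_sq \<phi> - \<tau> * (c * ell2_sq \<phi>)"
      using lower[OF \<phi>] \<tau>(1) by simp
    finally show ?thesis by (simp add: r_def algebra_simps)
  qed
  define g where "g k = (S ^^ k) f" for k
  have g_Suc: "g (Suc k) = S (g k)" for k by (simp add: g_def)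
  have g_ell2: "g k \<in> ell2" for k by (induction k) (use f in \<open>simp_all add: g_Suc S_ell2\<close>, simp add: g_def)
  define s D where "s = sqrt r" and "D = sqrt (ell2_sq f)"
  have s: "0 \<le> s" "s < 1" "s * s = r" using r by (simp_all add: s_def)
  have D: "0 \<le> D" "D * D = ell2_sq f" using ell2_sq_nonneg[of f] by (simp_all add: D_def)
  have g_sq: "ell2_sq (g k) \<le> (D * s ^ k)\<^sup>2" for k
  proof (induction k)
    case 0
    then show ?case using D by (simp add: g_def power2_eq_square)
  next
    case (Suc k)
    have "ell2_sq (g (Suc k)) \<le> r * ell2_sq (g k)" unfolding g_Suc by (rule S_sq[OF g_ell2])
    also have "\<dots> \<le> r * (D * s ^ k)\<^sup>2" using Suc r by (intro mult_left_mono)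
    also have "\<dots> = (D * s ^ Suc k)\<^sup>2" unfolding s(3)[symmetric] by (simp add: power2_eq_square mult_ac)
    finally show ?case .
  qed
  have g_pt: "cmod (g k n) \<le> D * s ^ k" for k n
    by (rule power2_le_imp_le[OF order_trans[OF cmod_le_ell2_sq[OF g_ell2] g_sq]]) (use D s in simp)
  have geo: "summable (\<lambda>k. D * s ^ k)" using s by (intro summable_mult summable_geometric) simp
  have g_summable: "summable (\<lambda>k. g k n)" for n
    by (rule summable_comparison_test'[OF geo, of 0]) (rule g_pt)
  define G where "G n = (\<Sum>k. g k n)" for n
  have "G \<in> ell2"
  proof (rule ell2I_bound(1))
    fix F :: "int set" assume F: "finite F"
    \<comment> \<open>\<open>G\<close> is a pointwise limit, so its square sum is bounded over
      finite sets first: Minkowski's inequality bounds all partial sums by the geometric series,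
      independently of \<open>F\<close>.\<close>
    have fin: "L2_set (\<lambda>n. cmod (\<Sum>k<m. g k n)) F \<le> (\<Sum>k<m. D * s ^ k)" for m
    proof (induction m)
      case (Suc m)
      have "L2_set (\<lambda>n. cmod (\<Sum>k<Suc m. g k n)) F
          \<le> L2_set (\<lambda>n. cmod (\<Sum>k<m. g k n) + cmod (g m n)) F"
        by (intro L2_set_mono) (auto intro: norm_triangle_ineq)
      also have "\<dots> \<le> L2_set (\<lambda>n. cmod (\<Sum>k<m. g k n)) F + L2_set (\<lambda>n. cmod (g m n)) F"
        by (rule L2_set_triangle_ineq)
      also have "L2_set (\<lambda>n. cmod (g m n)) F \<le> D * s ^ m"
        unfolding L2_set_def
        using sum_le_ell2_sq[OF g_ell2 F, of m] g_sq[of m] D s by (intro real_le_lsqrt) auto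
      finally show ?case using Suc by simp
    qed (simp add: L2_set_def)
    have "(\<lambda>m. L2_set (\<lambda>n. cmod (\<Sum>k<m. g k n)) F) \<longlonglongrightarrow> L2_set (\<lambda>n. cmod (G n)) F"
      unfolding L2_set_def G_def
      by (intro tendsto_intros summable_LIMSEQ g_summable)
    moreover have "(\<Sum>k<m. D * s ^ k) \<le> (\<Sum>k. D * s ^ k)" for m
      using D s by (intro sum_le_suminf geo) auto
    with fin have "L2_set (\<lambda>n. cmod (\<Sum>k<m. g k n)) F \<le> (\<Sum>k. D * s ^ k)" for m
      using order_trans by blast
    ultimately have "L2_set (\<lambda>n. cmod (G n)) F \<le> (\<Sum>k. D * s ^ k)"
      by (intro LIMSEQ_le_const2) auto
    then show "(\<Sum>n\<in>F. (cmod (G n))\<^sup>2) \<le> (\<Sum>k. D * s ^ k)\<^sup>2"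
      unfolding L2_set_def by (rule sqrt_le_D)
  qed
  \<comment> \<open>At each site the operator involves three values only and so commutes with
    pointwise convergent series; afterwards \<open>g k - g (Suc k)\<close> telescopes.\<close>
  have jacobi_sums: "(\<lambda>k. jacobi v w (\<lambda>n. u k n) n) sums jacobi v w U n"
    if "\<And>n. (\<lambda>k. u k n) sums U n" for w u U n
    unfolding jacobi_def by (intro sums_add sums_mult that)
  have "(\<lambda>k. ?J (?J' (g k)) n) sums ?J (?J' G) n" for n
    by (intro jacobi_sums) (simp add: G_def summable_sums g_summable)
  then have "(\<lambda>k. of_real \<tau> * ?J (?J' (g k)) n) sums (of_real \<tau> * ?J (?J' G) n)" for n
    by (rule sums_mult)
  moreover have "of_real \<tau> * ?J (?J' (g k)) n = g k n - g (Suc k) n" for k n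
    by (simp add: g_Suc S_def)
  moreover have "(\<lambda>k. g k n - g (Suc k) n) sums (g 0 n - 0)" for n
    by (intro telescope_sums' summable_LIMSEQ_zero g_summable)
  ultimately have "of_real \<tau> * ?J (?J' G) n = f n" for n
    using sums_unique2 by (fastforce simp: g_def)
  then have "?J (\<lambda>n. 0 + of_real \<tau> * ?J' G n) = f"
    unfolding jacobi_add_scale by (simp add: fun_eq_iff jacobi_def[of _ _ "\<lambda>n. 0"])
  moreover have "(\<lambda>n. 0 + of_real \<tau> * ?J' G n) \<in> ell2"
    using ell2_scale jacobi_ell2[OF \<open>G \<in> ell2\<close>] by simp
  ultimately show ?thesis by blast
qed

text \<open>A lower bound at \<open>z\<close> gives injectivity and the bounded inverse. The same
  bound holds at \<open>cnj z\<close>, that is for the adjoint, and this gives surjectivity.\<close>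

lemma not_in_spectrum:
  assumes "c > 0" and lower: "\<And>\<phi>. \<phi> \<in> ell2 \<Longrightarrow> c * ell2_sq \<phi> \<le> ell2_sq (jacobi v z \<phi>)"
    and T: "\<And>\<psi> n. T \<psi> n - z * \<psi> n = jacobi v z \<psi> n"
  shows "z \<notin> ell2_spectrum T"
proof -
  have T': "(\<lambda>\<psi> n. T \<psi> n - z * \<psi> n) = jacobi v z" by (intro ext T)
  have "c * ell2_sq \<phi> \<le> ell2_sq (jacobi v (cnj z) \<phi>)" if "\<phi> \<in> ell2" for \<phi>
    using lower[OF that] jacobi_sq_split[OF that, of z] jacobi_sq_split[OF that, of "cnj z"] by simp
  note surj = jacobi_surj[OF \<open>c > 0\<close> this]
  have "inj_on (jacobi v z) ell2"
  proof (rule inj_onI)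
    fix \<phi> \<theta> assume *: "\<phi> \<in> ell2" "\<theta> \<in> ell2" "jacobi v z \<phi> = jacobi v z \<theta>"
    have d: "(\<lambda>n. \<phi> n + (- 1) * \<theta> n) \<in> ell2" using * by (intro ell2_add_scale)
    have "jacobi v z (\<lambda>n. \<phi> n + (- 1) * \<theta> n) = (\<lambda>n. 0)" unfolding jacobi_add_scale * by simp
    then have "c * ell2_sq (\<lambda>n. \<phi> n + (- 1) * \<theta> n) \<le> 0"
      using lower[OF d] by (simp add: ell2_sq_def)
    then have "ell2_sq (\<lambda>n. \<phi> n + (- 1) * \<theta> n) \<le> 0" using \<open>c > 0\<close> by (simp add: mult_le_0_iff)
    from ell2_sq_eq_0[OF d this] show "\<phi> = \<theta>" by (simp add: fun_eq_iff)
  qed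
  then have "bij_betw (jacobi v z) ell2 ell2"
    unfolding bij_betw_def using surj jacobi_ell2 by (auto simp: image_iff)
  moreover have "ell2_norm \<psi> \<le> (1 / sqrt c) * ell2_norm (jacobi v z \<psi>)" if "\<psi> \<in> ell2" for \<psi>
  proof -
    have "sqrt c * sqrt (ell2_sq \<psi>) \<le> sqrt (ell2_sq (jacobi v z \<psi>))"
      using lower[OF that] by (simp flip: real_sqrt_mult)
    then show ?thesis using \<open>c > 0\<close> by (simp add: ell2_norm_sq field_simps)
  qed
  then have "\<exists>B. \<forall>\<psi>\<in>ell2. ell2_norm \<psi> \<le> B * ell2_norm (jacobi v z \<psi>)" by (intro exI ballI)
  ultimately show ?thesis unfolding ell2_spectrum_def mem_Collect_eq not_not T by (rule conjI)
qed

lemma lower_bound_extends: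
  assumes fin: "\<And>\<phi> m. (\<And>n. \<bar>n\<bar> > int m \<Longrightarrow> \<phi> n = 0) \<Longrightarrow>
      c * (\<Sum>n\<in>{- int m..int m}. (cmod (\<phi> n))\<^sup>2)
        \<le> (\<Sum>n\<in>{- int m - 1..int m + 1}. (cmod (jacobi v z \<phi> n))\<^sup>2)"
    and "c > 0" and \<psi>: "\<psi> \<in> ell2"
  shows "c * ell2_sq \<psi> \<le> ell2_sq (jacobi v z \<psi>)"
proof -
  \<comment> \<open>The cut-off error: the squared values that the operator takes on the truncated
    sequence at the sites \<open>m\<close>, \<open>m + 1\<close>, \<open>- m\<close>,
    \<open>- m - 1\<close>. At all other sites the truncation is invisible or the value is
    0.\<close>
  define e where "e m = (cmod (\<psi> (int m - 1) + (of_real (v (int m)) - z) * \<psi> (int m)))\<^sup>2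
    + (cmod (\<psi> (int m)))\<^sup>2
    + (cmod (\<psi> (- int m + 1) + (of_real (v (- int m)) - z) * \<psi> (- int m)))\<^sup>2
    + (cmod (\<psi> (- int m)))\<^sup>2" for m :: nat
  have lim: "(\<lambda>m. \<psi> (g m)) \<longlonglongrightarrow> 0" if "inj g" for g :: "nat \<Rightarrow> int"
  proof -
    have "(\<lambda>n. (cmod (\<psi> n))\<^sup>2) summable_on range g"
      by (rule summable_on_subset_banach[OF ell2_summable[OF \<psi>]]) simp
    then have "(\<lambda>m. (cmod (\<psi> (g m)))\<^sup>2) summable_on UNIV"
      using summable_on_reindex[OF that, of "\<lambda>n. (cmod (\<psi> n))\<^sup>2"] by (simp add: o_def)
    then have "summable (\<lambda>m. (cmod (\<psi> (g m)))\<^sup>2)"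
      by (rule summable_on_imp_summable)
    then have "(\<lambda>m. (cmod (\<psi> (g m)))\<^sup>2) \<longlonglongrightarrow> 0" by (rule summable_LIMSEQ_zero)
    then have "(\<lambda>m. sqrt ((cmod (\<psi> (g m)))\<^sup>2)) \<longlonglongrightarrow> sqrt 0" by (rule tendsto_real_sqrt)
    then show ?thesis by (simp add: tendsto_norm_zero_iff)
  qed
  have lim_mult: "(\<lambda>m. (of_real (v (g m)) - z) * \<psi> (g m)) \<longlonglongrightarrow> 0" if "inj g" for g :: "nat \<Rightarrow> int"
  proof (rule Lim_null_comparison)
    show "\<forall>\<^sub>F m in sequentially. norm ((of_real (v (g m)) - z) * \<psi> (g m)) \<le> (W + cmod z) * cmod (\<psi> (g m))"
      unfolding norm_mult by (intro always_eventually allI mult_right_mono coeff_bound) simp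
    show "(\<lambda>m. (W + cmod z) * cmod (\<psi> (g m))) \<longlonglongrightarrow> 0"
      using tendsto_mult_left[OF tendsto_norm[OF lim[OF that]], of "W + cmod z"] by simp
  qed
  have inj: "inj (\<lambda>m. int m - 1)" "inj int" "inj (\<lambda>m. - int m + 1)" "inj (\<lambda>m. - int m)"
    by (auto intro: injI)
  have "e \<longlonglongrightarrow> (cmod (0 + 0))\<^sup>2 + (cmod 0)\<^sup>2 + (cmod (0 + 0))\<^sup>2 + (cmod 0)\<^sup>2"
    unfolding e_def by (intro tendsto_intros lim lim_mult inj)
  then have "e \<longlonglongrightarrow> 0" by simp
  have main: "c * (\<Sum>n\<in>{- int m..int m}. (cmod (\<psi> n))\<^sup>2) \<le> ell2_sq (jacobi v z \<psi>) + e m"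
    if "m > 0" for m
  proof -
    define \<phi> where "\<phi> n = (if \<bar>n\<bar> \<le> int m then \<psi> n else 0)" for n
    have split: "{- int m - 1..int m + 1}
        = {- int m + 1..int m - 1} \<union> {int m, int m + 1, - int m, - int m - 1}"
      using that by auto
    have "c * (\<Sum>n\<in>{- int m..int m}. (cmod (\<psi> n))\<^sup>2) = c * (\<Sum>n\<in>{- int m..int m}. (cmod (\<phi> n))\<^sup>2)"
      by (intro arg_cong[where f = "\<lambda>x. c * x"] sum.cong) (auto simp: \<phi>_def)
    also have "\<dots> \<le> (\<Sum>n\<in>{- int m - 1..int m + 1}. (cmod (jacobi v z \<phi> n))\<^sup>2)"
      by (rule fin) (simp add: \<phi>_def)
    also have "\<dots> = (\<Sum>n\<in>{- int m + 1..int m - 1}. (cmod (jacobi v z \<phi> n))\<^sup>2)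
        + (\<Sum>n\<in>{int m, int m + 1, - int m, - int m - 1}. (cmod (jacobi v z \<phi> n))\<^sup>2)"
      unfolding split by (intro sum.union_disjoint) auto
    also have "(\<Sum>n\<in>{- int m + 1..int m - 1}. (cmod (jacobi v z \<phi> n))\<^sup>2)
        = (\<Sum>n\<in>{- int m + 1..int m - 1}. (cmod (jacobi v z \<psi> n))\<^sup>2)"
      by (intro sum.cong refl) (auto simp: jacobi_def \<phi>_def)
    also have "\<dots> \<le> ell2_sq (jacobi v z \<psi>)" by (intro sum_le_ell2_sq jacobi_ell2 \<psi>) simp
    also have "(\<Sum>n\<in>{int m, int m + 1, - int m, - int m - 1}. (cmod (jacobi v z \<phi> n))\<^sup>2) = e m"
      using that by (simp add: jacobi_def \<phi>_def e_def)
    finally show ?thesis by simp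
  qed
  have "(\<Sum>n\<in>F. (cmod (\<psi> n))\<^sup>2) \<le> ell2_sq (jacobi v z \<psi>) / c" if F: "finite F" for F
  proof -
    define b where "b = (\<Sum>n\<in>F. \<bar>n\<bar>)"
    have b: "\<bar>n\<bar> \<le> b" if "n \<in> F" for n
      unfolding b_def using that F by (intro member_le_sum) auto
    have "\<forall>\<^sub>F m in sequentially. c * (\<Sum>n\<in>F. (cmod (\<psi> n))\<^sup>2) \<le> ell2_sq (jacobi v z \<psi>) + e m"
      unfolding eventually_sequentially
    proof (intro exI allI impI)
      fix m :: nat assume "m \<ge> nat b + 1"
      then have m: "m > 0" "F \<subseteq> {- int m..int m}" using b by (auto, fastforce+)
      have "c * (\<Sum>n\<in>F. (cmod (\<psi> n))\<^sup>2) \<le> c * (\<Sum>n\<in>{- int m..int m}. (cmod (\<psi> n))\<^sup>2)"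
        using m(2) \<open>c > 0\<close> by (intro mult_left_mono sum_mono2) auto
      with main[OF m(1)] show "c * (\<Sum>n\<in>F. (cmod (\<psi> n))\<^sup>2) \<le> ell2_sq (jacobi v z \<psi>) + e m" by linarith
    qed
    then have "c * (\<Sum>n\<in>F. (cmod (\<psi> n))\<^sup>2) \<le> ell2_sq (jacobi v z \<psi>) + 0"
      by (intro tendsto_lowerbound[OF tendsto_add[OF tendsto_const \<open>e \<longlonglongrightarrow> 0\<close>]]) simp_all
    then show ?thesis using \<open>c > 0\<close> by (simp add: field_simps)
  qed
  from ell2I_bound(2)[OF this] show ?thesis using \<open>c > 0\<close> by (simp add: field_simps)
qed

end

section \<open>Traces on the spectrum\<close>

lemma fib_H_jacobi: "fib_H V \<omega> \<psi> n - z * \<psi> n = jacobi (fib_potential V \<omega>) z \<psi> n"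
  by (simp add: fib_H_def jacobi_def algebra_simps)

lemma bounded_jacobi_fib: "V \<ge> 0 \<Longrightarrow> bounded_jacobi (fib_potential V \<omega>) V"
  by unfold_locales (simp add: fib_potential_height)

text \<open>For real energy the operator acts separately on real and imaginary parts, so the real
  estimate applies to each.\<close>

lemma fib_finite_lower_bound:
  fixes E :: real and \<phi> :: "int \<Rightarrow> complex"
  assumes esc: "\<And>E' j. \<bar>E' - E\<bar> < \<delta> \<Longrightarrow> j \<ge> k0 \<Longrightarrow> cmod (fibtr V (complex_of_real E') j) > 2"
    and "\<delta> \<ge> 0" and supp: "\<And>n. \<bar>n\<bar> > int m \<Longrightarrow> \<phi> n = 0"
  shows "\<delta>\<^sup>2 * (\<Sum>n\<in>{- int m..int m}. (cmod (\<phi> n))\<^sup>2)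
    \<le> (\<Sum>n\<in>{- int m - 1..int m + 1}. (cmod (jacobi (fib_potential V \<omega>) (of_real E) \<phi> n))\<^sup>2)"
proof -
  \<comment> \<open>Translation by \<open>m + 1\<close> moves the support \<open>- m..m\<close> to
    \<open>1..2 * m + 1\<close>; the change of phase in \<open>\<omega>'\<close> absorbs it.\<close>
  define s where "s = int m + 1"
  define \<omega>' where "\<omega>' = \<omega> - of_int s * \<alpha>"
  let ?I = "{0..int (2 * m + 1) + 1}" and ?I' = "{- int m - 1..int m + 1}"
  have pot: "fib_potential V \<omega>' n = fib_potential V \<omega> (n - s)" for n
    by (simp add: fib_potential_def \<omega>'_def algebra_simps)
  have real: "\<delta>\<^sup>2 * (\<Sum>n\<in>?I'. (\<psi> n)\<^sup>2)
      \<le> (\<Sum>n\<in>?I'. (\<psi> (n + 1) + \<psi> (n - 1) + (fib_potential V \<omega> n - E) * \<psi> n)\<^sup>2)"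
    if "\<And>n. \<bar>n\<bar> > int m \<Longrightarrow> \<psi> n = 0" for \<psi> :: "int \<Rightarrow> real"
  proof -
    have "1 \<le> n \<and> n \<le> int (2 * m + 1)" if "\<psi> (n - s) \<noteq> 0" for n
      using that \<open>\<And>n. \<bar>n\<bar> > int m \<Longrightarrow> \<psi> n = 0\<close>[of "n - s"] by (fastforce simp: s_def)
    from window_lower_bound[where E = E and ?k0.0 = k0 and \<omega> = \<omega>'
        and \<psi> = "\<lambda>n. \<psi> (n - s)" and M = "2 * m + 1", OF esc \<open>\<delta> \<ge> 0\<close> this]
    have "\<delta>\<^sup>2 * (\<Sum>n\<in>?I. (\<psi> (n - s))\<^sup>2) \<le> (\<Sum>n\<in>?I. (\<psi> (n + 1 - s) + \<psi> (n - 1 - s)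
        + (fib_potential V \<omega> (n - s) - E) * \<psi> (n - s))\<^sup>2)"
      unfolding pot .
    moreover have "(\<Sum>n\<in>?I. f (n - s)) = sum f ?I'" for f :: "int \<Rightarrow> real"
      by (rule sum.reindex_bij_witness[of _ "\<lambda>n. n + s" "\<lambda>n. n - s"]) (auto simp: s_def)
    from this[of "\<lambda>n. (\<psi> n)\<^sup>2"]
      this[of "\<lambda>n. (\<psi> (n + 1) + \<psi> (n - 1) + (fib_potential V \<omega> n - E) * \<psi> n)\<^sup>2"]
    have "(\<Sum>n\<in>?I. (\<psi> (n - s))\<^sup>2) = (\<Sum>n\<in>?I'. (\<psi> n)\<^sup>2)"
      "(\<Sum>n\<in>?I. (\<psi> (n + 1 - s) + \<psi> (n - 1 - s) + (fib_potential V \<omega> (n - s) - E) * \<psi> (n - s))\<^sup>2)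
        = (\<Sum>n\<in>?I'. (\<psi> (n + 1) + \<psi> (n - 1) + (fib_potential V \<omega> n - E) * \<psi> n)\<^sup>2)"
      by (simp_all add: algebra_simps)
    ultimately show ?thesis by simp
  qed
  have "(\<Sum>n\<in>{- int m..int m}. (cmod (\<phi> n))\<^sup>2) = (\<Sum>n\<in>?I'. (cmod (\<phi> n))\<^sup>2)"
    using supp by (intro sum.mono_neutral_left) auto
  also have "\<delta>\<^sup>2 * \<dots> = \<delta>\<^sup>2 * (\<Sum>n\<in>?I'. (Re (\<phi> n))\<^sup>2) + \<delta>\<^sup>2 * (\<Sum>n\<in>?I'. (Im (\<phi> n))\<^sup>2)"
    by (simp add: cmod_power2 sum.distrib distrib_left)
  also have "\<dots> \<le> (\<Sum>n\<in>?I'. (Re (\<phi> (n + 1)) + Re (\<phi> (n - 1)) + (fib_potential V \<omega> n - E) * Re (\<phi> n))\<^sup>2)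
      + (\<Sum>n\<in>?I'. (Im (\<phi> (n + 1)) + Im (\<phi> (n - 1)) + (fib_potential V \<omega> n - E) * Im (\<phi> n))\<^sup>2)"
    by (intro add_mono real) (simp_all add: supp)
  also have "\<dots> = (\<Sum>n\<in>?I'. (cmod (jacobi (fib_potential V \<omega>) (of_real E) \<phi> n))\<^sup>2)"
    by (simp add: jacobi_def cmod_power2 sum.distrib)
  finally show ?thesis .
qed

lemma fib_spectrum_traces:
  assumes "V > 0" and E: "E \<in> fib_spectrum V"
  shows "cmod (fibtr V E k) \<le> 2 + V"
proof -
  obtain \<omega> where \<omega>: "E \<in> ell2_spectrum (fib_H V \<omega>)"
    using E by (auto simp: fib_spectrum_def)
  interpret bounded_jacobi "fib_potential V \<omega>" V using \<open>V > 0\<close> by (intro bounded_jacobi_fib) simp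
  have "Im E = 0"
  proof (rule ccontr)
    assume "Im E \<noteq> 0"
    have "(Im E)\<^sup>2 * ell2_sq \<phi> \<le> ell2_sq (jacobi (fib_potential V \<omega>) E \<phi>)" if "\<phi> \<in> ell2" for \<phi>
      using jacobi_sq_split[OF that, of E] ell2_sq_nonneg by simp
    then have "E \<notin> ell2_spectrum (fib_H V \<omega>)"
      using \<open>Im E \<noteq> 0\<close> by (intro not_in_spectrum[where c = "(Im E)\<^sup>2"] fib_H_jacobi) simp_all
    with \<omega> show False by simp
  qed
  then have E_real: "E = of_real (Re E)" by (simp add: complex_eq_iff)
  have "\<not> (cmod (fibtr V E k) > 2 \<and> cmod (fibtr V E (k + 1)) > 2)" for k
  proof
    assume "cmod (fibtr V E k) > 2 \<and> cmod (fibtr V E (k + 1)) > 2"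
    then obtain k0 \<delta> where \<delta>: "\<delta> > 0"
      and esc: "\<And>E' j. cmod (E' - E) < \<delta> \<Longrightarrow> j \<ge> k0 \<Longrightarrow> cmod (fibtr V E' j) > 2"
      using fibtr_escape_open by metis
    have esc': "cmod (fibtr V (complex_of_real E') j) > 2" if "\<bar>E' - Re E\<bar> < \<delta>" "j \<ge> k0" for E' j
    proof (rule esc[OF _ that(2)])
      have "complex_of_real E' - E = of_real (E' - Re E)" by (subst E_real) simp
      then show "cmod (complex_of_real E' - E) < \<delta>" using that(1) by (simp only: norm_of_real)
    qed
    have fin: "\<delta>\<^sup>2 * (\<Sum>n\<in>{- int m..int m}. (cmod (\<phi> n))\<^sup>2)
        \<le> (\<Sum>n\<in>{- int m - 1..int m + 1}. (cmod (jacobi (fib_potential V \<omega>) E \<phi> n))\<^sup>2)"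
      if "\<And>n. \<bar>n\<bar> > int m \<Longrightarrow> \<phi> n = 0" for \<phi> m
      using fib_finite_lower_bound[where E = "Re E" and ?k0.0 = k0 and \<phi> = \<phi> and \<omega> = \<omega>,
          OF esc' less_imp_le[OF \<delta>] that] E_real by simp
    have "\<delta>\<^sup>2 * ell2_sq \<phi> \<le> ell2_sq (jacobi (fib_potential V \<omega>) E \<phi>)" if "\<phi> \<in> ell2" for \<phi>
      by (rule lower_bound_extends[OF fin _ that]) (use \<delta> in simp_all)
    then have "E \<notin> ell2_spectrum (fib_H V \<omega>)"
      using \<delta> by (intro not_in_spectrum[where c = "\<delta>\<^sup>2"] fib_H_jacobi) simp_all
    with \<omega> show False by simp
  qed
  moreover have "E \<in> \<real>" using E_real by (metis Reals_of_real)
  ultimately show ?thesis using \<open>V > 0\<close> by (intro fibtr_bounded) auto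
qed

section \<open>The growth exponent\<close>

text \<open>With \<open>t^2 = 2 + V\<close> the cubic takes the value -1 at \<open>t\<close> and
  \<open>2 t^2 + 3 t\<close> at \<open>t + 1\<close>, so it has a root above
  \<open>t\<close>.\<close>

lemma fib_a_ge:
  assumes "V > 0"
  shows "sqrt (2 + V) \<le> fib_a V"
proof -
  define f where "f x = x ^ 3 - (2 + V) * x - 1" for x :: real
  define t where "t = sqrt (2 + V)"
  have t: "t > 0" "t * t = 2 + V" using assms by (simp_all add: t_def)
  have "f t = t * (t * t) - (2 + V) * t - 1" by (simp add: f_def power3_eq_cube)
  then have "f t \<le> 0" unfolding t(2) by simp
  have "f (t + 1) = t * (t * t) + 3 * (t * t) + 3 * t + 1 - (2 + V) * t - (2 + V) - 1"
    by (simp add: f_def power3_eq_cube algebra_simps)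
  then have "f (t + 1) \<ge> 0" unfolding t(2) using t assms by (simp add: algebra_simps)
  have "continuous_on {t..t + 1} f" unfolding f_def by (intro continuous_intros)
  with \<open>f t \<le> 0\<close> \<open>f (t + 1) \<ge> 0\<close> obtain x where x: "t \<le> x" "f x = 0"
    using IVT'[of f t 0 "t + 1"] by auto
  have "finite {x. f x = 0}"
  proof -
    have "poly [:- 1, - (2 + V), 0, 1:] x = f x" for x
      by (simp add: f_def power3_eq_cube algebra_simps)
    then show ?thesis using poly_roots_finite[of "[:- 1, - (2 + V), 0, 1:]"] by simp
  qed
  then have "x \<le> fib_a V" using x(2) unfolding fib_a_def f_def by (intro Max_ge) auto
  with x(1) show ?thesis by (simp add: t_def)
qed

lemma growth_rate_le:
  assumes "V > 0"
  shows "growth_rate (2 + V) \<le> sqrt (5 + 2 * V) * (3 + V) * fib_a V"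
proof -
  have "7 / 5 * (2 + V) + 3 / 10 \<le> sqrt ((5 + 2 * V) * (2 + V))"
  proof (rule real_le_rsqrt)
    show "(7 / 5 * (2 + V) + 3 / 10)\<^sup>2 \<le> (5 + 2 * V) * (2 + V)"
      using assms by (simp add: power2_eq_square field_simps)
  qed
  also have "\<dots> = sqrt (5 + 2 * V) * sqrt (2 + V)" by (rule real_sqrt_mult)
  also have "\<dots> \<le> sqrt (5 + 2 * V) * fib_a V"
    using fib_a_ge[OF assms] assms by (intro mult_left_mono) auto
  finally have "(7 / 5 * (2 + V) + 3 / 10) * (3 + V) \<le> sqrt (5 + 2 * V) * fib_a V * (3 + V)"
    using assms by (intro mult_right_mono) auto
  then show ?thesis by (simp add: growth_rate_def mult_ac)
qed

theorem theorem5p1: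
  fixes V \<zeta> :: real
  assumes "V > 0"
    and "\<zeta> > ln (sqrt (5 + 2 * V) * (3 + V) * fib_a V) / ln ((sqrt 5 + 1) / 2)"
  shows "\<exists>C>0. \<forall>\<omega>::real. \<forall>E\<in>fib_spectrum V. \<forall>N::nat. N \<ge> 1 \<longrightarrow>
           (\<forall>n m :: int. \<bar>n - m\<bar> \<le> int N \<longrightarrow>
              opnorm (fib_transfer V n m \<omega> E) \<le> C * real N powr \<zeta>)"
proof -
  define T \<rho> \<phi> where "T = 2 + V" and "\<rho> = sqrt (5 + 2 * V) * (3 + V) * fib_a V"
    and "\<phi> = (sqrt 5 + 1) / 2"
  have \<phi>: "1 / \<alpha> = \<phi>" "\<phi> > 1"
    using inverse_alpha alpha_bounds by (simp_all add: \<phi>_def \<alpha>_def field_simps)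
  have rate: "growth_rate T \<le> \<rho>" "growth_rate T \<ge> 1"
  proof -
    show "growth_rate T \<le> \<rho>" using growth_rate_le[OF assms(1)] by (simp add: T_def \<rho>_def)
    have "7 / 5 * T + 3 / 10 \<ge> 1" using assms(1) by (simp add: T_def field_simps)
    then have "growth_rate T \<ge> 1 * 1"
      unfolding growth_rate_def using assms(1) by (intro mult_mono) (auto simp: T_def)
    then show "growth_rate T \<ge> 1" by simp
  qed
  define C1 where "C1 = T\<^sup>2 * ((1 + T)\<^sup>2) ^ 5 * (2 + (T + 2) + (T + 2) + (T + 2) * (T + 2))"
  have "T > 2" using assms(1) by (simp add: T_def)
  then have "C1 > 0" by (simp add: C1_def add_pos_pos)
  define \<gamma> where "\<gamma> = ln \<rho> / ln \<phi>"
  have "\<rho> \<ge> 1" using rate by linarith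
  then have \<gamma>: "\<gamma> \<ge> 0" "\<gamma> < \<zeta>" using \<phi> assms(2) by (simp_all add: \<gamma>_def \<rho>_def \<phi>_def)
  \<comment> \<open>\<gamma> converts the number of levels into a power of the length: each level
    multiplies the length by \<open>\<phi>\<close> and the bound by \<open>\<rho>\<close>.\<close>
  have \<phi>_powr: "(\<phi> ^ k) powr \<gamma> = \<rho> ^ k" for k
  proof -
    have "\<phi> powr \<gamma> = \<rho>" using \<phi> \<open>\<rho> \<ge> 1\<close> by (simp add: \<gamma>_def powr_def)
    then show ?thesis using \<phi> by (metis powr_power less_trans zero_less_one powr_gt_zero
          mult.commute powr_powr powr_realpow)
  qed
  have bound: "opnorm (fib_transfer V n m \<omega> E) \<le> C1 * \<rho> * real N powr \<zeta>"
    if E: "E \<in> fib_spectrum V" and N: "N \<ge> 1" and nm: "\<bar>n - m\<bar> \<le> int N" for \<omega> E N n m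
  proof -
    obtain K where K: "real N < \<phi> ^ K" using real_arch_pow[OF \<phi>(2)] by blast
    \<comment> \<open>Minimality gives \<open>\<phi> ^ (k - 1) \<le> N\<close>; the one level in
      excess accounts for the factor \<open>\<rho>\<close> in the constant.\<close>
    define k where "k = (LEAST k. real N < \<phi> ^ k)"
    have k: "real N < \<phi> ^ k" unfolding k_def by (rule LeastI[of _ K]) (rule K)
    then have "k \<noteq> 0" using N by (cases k) auto
    then obtain k' where k': "k = Suc k'" by (cases k) auto
    have "\<phi> ^ k' \<le> real N"
      using not_less_Least[of k' "\<lambda>k. real N < \<phi> ^ k"] k' by (simp add: k_def)
    then have "(\<phi> ^ k') powr \<gamma> \<le> real N powr \<gamma>" using \<gamma> \<phi> by (intro powr_mono2) auto
    then have "\<rho> ^ k' \<le> real N powr \<gamma>" unfolding \<phi>_powr .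
    also have "\<dots> \<le> real N powr \<zeta>" using N \<gamma> by (intro powr_mono) auto
    finally have pow: "\<rho> ^ k' \<le> real N powr \<zeta>" .
    have "\<bar>real_of_int (n - m)\<bar> \<le> (1 / \<alpha>) ^ k" using nm k unfolding \<phi>(1) by linarith
    then have "opnorm (fib_transfer V n m \<omega> E)
        \<le> T\<^sup>2 * ((1 + T)\<^sup>2) ^ 5 * growth_rate T ^ k * (2 + (T + 2) + (T + 2) + (T + 2) * (T + 2))"
      using fib_spectrum_traces[OF assms(1) E] \<open>T > 2\<close>
      by (intro fib_transfer_growth) (auto simp: T_def)
    also have "\<dots> = C1 * growth_rate T ^ k" by (simp add: C1_def)
    also have "\<dots> \<le> C1 * \<rho> ^ k"
      using rate \<open>C1 > 0\<close> by (intro mult_left_mono power_mono) auto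
    also have "\<dots> = C1 * \<rho> * \<rho> ^ k'" by (simp add: k')
    also have "\<dots> \<le> C1 * \<rho> * real N powr \<zeta>"
      using pow \<open>C1 > 0\<close> \<open>\<rho> \<ge> 1\<close> by (intro mult_left_mono) auto
    finally show ?thesis .
  qed
  show ?thesis
    by (intro exI[of _ "C1 * \<rho>"] conjI allI ballI impI bound) (use \<open>C1 > 0\<close> \<open>\<rho> \<ge> 1\<close> in auto)
qed

end
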